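(* Let $U$ be a finite set, $\mathcal{F}\subseteq 2^U$ a fixed efficiently listable closure difference and $R$ a commutative ring with unit. Given tables $A,B\colon\mathcal{F}^{[k]}\to R$, their componentwise cover product $A\otimes_{comp}B$ can be computed in $\mathcal{O}(k|\mathcal{F}|^k|U|)$ ring operations and additional time $\mathcal{O}^*(|\mathcal{F}|^k)$.
   Context: $\uparrow(\mathcal{G})=\{S\subseteq U:\exists T\in\mathcal{G},T\subseteq S\}$; $\mathcal{F}$ is a closure difference if $\mathcal{F}=\uparrow(\mathcal{F}_+)\setminus\uparrow(\mathcal{F}_-)$ for some families $\mathcal{F}_+,\mathcal{F}_-$. $\mathcal{F}$ is efficiently listable if some algorithm outputs all members of $\mathcal{F}$ (as bitstrings, sorted) in time $|\mathcal{F}||U|^{\mathcal{O}(1)}$. $\mathcal{F}^{[k]}$ denotes the set of functions $[k]\to\mathcal{F}$, and $(A\otimes_{comp}B)(f)=\sum_{f_1,f_2\in\mathcal{F}^{[k]}:\ f_1(i)\cup f_2(i)=f(i)\ \forall i\in[k]}A(f_1)B(f_2)$. $\mathcal{O}^*$ hides factors polynomial in $k$ and $|U|$. *)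

theory Defs
  imports Complex_Main "HOL-Library.FuncSet" "HOL-Library.List_Lexorder"
    "HOL-Library.Discrete_Functions"
begin

section \<open>Closure differences and the componentwise cover product\<close>

definition up_closure :: "'u set \<Rightarrow> 'u set set \<Rightarrow> 'u set set" where
  "up_closure U G = {S. S \<subseteq> U \<and> (\<exists>T\<in>G. T \<subseteq> S)}"

definition closure_difference :: "'u set \<Rightarrow> 'u set set \<Rightarrow> bool" where
  "closure_difference U F \<longleftrightarrow>
     (\<exists>Fp Fm. Fp \<subseteq> Pow U \<and> Fm \<subseteq> Pow U \<and> F = up_closure U Fp - up_closure U Fm)"

text \<open>The sort \<open>{comm_ring, comm_monoid_mult}\<close> consists of the commutative rings with unit; unlike
  \<open>comm_ring_1\<close> it does not exclude the zero ring.\<close>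

definition tuples :: "'u set set \<Rightarrow> nat \<Rightarrow> (nat \<Rightarrow> 'u set) set" where
  "tuples F k = ({1..k} \<rightarrow>\<^sub>E F)"

definition comp_cover_product ::
  "'u set set \<Rightarrow> nat \<Rightarrow> ((nat \<Rightarrow> 'u set) \<Rightarrow> 'r::{comm_ring,comm_monoid_mult}) \<Rightarrow> ((nat \<Rightarrow> 'u set) \<Rightarrow> 'r)
     \<Rightarrow> (nat \<Rightarrow> 'u set) \<Rightarrow> 'r" where
  "comp_cover_product F k A B f =
     (\<Sum>(f1, f2) \<in> {(f1, f2). f1 \<in> tuples F k \<and> f2 \<in> tuples F k \<and>
                              (\<forall>i\<in>{1..k}. f1 i \<union> f2 i = f i)}. A f1 * B f2)"


section \<open>Random access machines with logarithmic cost\<close>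

text \<open>
  Structured programs over scalar registers and arrays of natural numbers. Time is the
  logarithmic (bit) cost: every operand, intermediate result and array index is charged its
  binary length, and multiplication and division are charged the product of the operand
  lengths. Hence a unit of time cannot hide operations on long numbers.
\<close>

definition bit_length :: "nat \<Rightarrow> nat" where
  "bit_length n = Suc (floor_log n)"

record store =
  scal :: "nat \<Rightarrow> nat"
  arr :: "nat \<Rightarrow> nat \<Rightarrow> nat"

datatype exp =
    Num nat
  | Var nat
  | Get nat exp
  | Add exp exp
  | Sub exp exp
  | Mul exp exp
  | Div exp exp

primrec eval :: "exp \<Rightarrow> store \<Rightarrow> nat" where
  "eval (Num n) s = n"
| "eval (Var x) s = scal s x"
| "eval (Get a e) s = arr s a (eval e s)"
| "eval (Add e f) s = eval e s + eval f s"
| "eval (Sub e f) s = eval e s - eval f s"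
| "eval (Mul e f) s = eval e s * eval f s"
| "eval (Div e f) s = eval e s div eval f s"

primrec eval_cost :: "exp \<Rightarrow> store \<Rightarrow> nat" where
  "eval_cost (Num n) s = bit_length n"
| "eval_cost (Var x) s = bit_length (scal s x)"
| "eval_cost (Get a e) s = eval_cost e s + bit_length (arr s a (eval e s))"
| "eval_cost (Add e f) s = eval_cost e s + eval_cost f s + bit_length (eval e s + eval f s)"
| "eval_cost (Sub e f) s = eval_cost e s + eval_cost f s + bit_length (eval e s - eval f s)"
| "eval_cost (Mul e f) s =
     eval_cost e s + eval_cost f s + bit_length (eval e s) * bit_length (eval f s)"
| "eval_cost (Div e f) s =
     eval_cost e s + eval_cost f s + bit_length (eval e s) * bit_length (eval f s)"

datatype com =
    Assign nat exp
  | Put nat exp exp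
  | Seq com com
  | If exp com com
  | While exp com

text \<open>\<open>exec c s t s'\<close>: started in \<open>s\<close>, program \<open>c\<close> halts in \<open>s'\<close> after time \<open>t\<close>.
  A test succeeds if its value is nonzero.\<close>

inductive exec :: "com \<Rightarrow> store \<Rightarrow> nat \<Rightarrow> store \<Rightarrow> bool" where
  Assign: "exec (Assign x e) s (Suc (eval_cost e s)) (s\<lparr>scal := (scal s)(x := eval e s)\<rparr>)"
| Put: "exec (Put a e f) s (Suc (eval_cost e s + eval_cost f s))
          (s\<lparr>arr := (arr s)(a := (arr s a)(eval e s := eval f s))\<rparr>)"
| Seq: "exec c s t s' \<Longrightarrow> exec d s' u s'' \<Longrightarrow> exec (Seq c d) s (t + u) s''"
| IfTrue: "eval e s \<noteq> 0 \<Longrightarrow> exec c s t s' \<Longrightarrow> exec (If e c d) s (Suc (eval_cost e s + t)) s'"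
| IfFalse: "eval e s = 0 \<Longrightarrow> exec d s t s' \<Longrightarrow> exec (If e c d) s (Suc (eval_cost e s + t)) s'"
| WhileFalse: "eval e s = 0 \<Longrightarrow> exec (While e c) s (Suc (eval_cost e s)) s"
| WhileTrue: "eval e s \<noteq> 0 \<Longrightarrow> exec c s t s' \<Longrightarrow> exec (While e c) s' u s'' \<Longrightarrow>
    exec (While e c) s (Suc (eval_cost e s + t + u)) s''"


section \<open>Algebraic programs over a ring\<close>

text \<open>
  The machine is extended by arrays of ring elements, accessible only through the ring
  operations; in particular there are no tests on ring elements, and programs contain no ring
  constants besides zero and one. A cell is given by the name of a ring array and an
  expression for the index.
\<close>

type_synonym cell = "nat \<times> exp"

type_synonym 'r config = "store \<times> (nat \<Rightarrow> nat \<Rightarrow> 'r)"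

datatype ring_op = RAdd | RSub | RMul

primrec ring_eval :: "ring_op \<Rightarrow> 'r::{comm_ring,comm_monoid_mult} \<Rightarrow> 'r \<Rightarrow> 'r" where
  "ring_eval RAdd x y = x + y"
| "ring_eval RSub x y = x - y"
| "ring_eval RMul x y = x * y"

definition read_cell :: "cell \<Rightarrow> 'r config \<Rightarrow> 'r" where
  "read_cell p = (\<lambda>(s, m). m (fst p) (eval (snd p) s))"

definition write_cell :: "cell \<Rightarrow> 'r \<Rightarrow> 'r config \<Rightarrow> 'r config" where
  "write_cell p v = (\<lambda>(s, m). (s, m(fst p := (m (fst p))(eval (snd p) s := v))))"

definition cell_cost :: "cell \<Rightarrow> 'r config \<Rightarrow> nat" where
  "cell_cost p \<sigma> = eval_cost (snd p) (fst \<sigma>)"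

datatype rcom =
    Plain com
  | RZero cell
  | ROne cell
  | RCopy cell cell
  | ROp ring_op cell cell cell
  | RSeq rcom rcom
  | RIf exp rcom rcom
  | RWhile exp rcom

text \<open>\<open>rexec c \<sigma> r t \<sigma>'\<close>: started in \<open>\<sigma>\<close>, program \<open>c\<close> halts in \<open>\<sigma>'\<close> after \<open>r\<close> ring
  operations and additional time \<open>t\<close>. The additional time includes the cost of addressing
  the operands of the ring operations.\<close>

inductive rexec :: "rcom \<Rightarrow> 'r::{comm_ring,comm_monoid_mult} config \<Rightarrow> nat \<Rightarrow> nat \<Rightarrow> 'r config \<Rightarrow> bool" where
  Plain: "exec c s t s' \<Longrightarrow> rexec (Plain c) (s, m) 0 t (s', m)"
| RZero: "rexec (RZero p) \<sigma> 0 (Suc (cell_cost p \<sigma>)) (write_cell p 0 \<sigma>)"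
| ROne: "rexec (ROne p) \<sigma> 0 (Suc (cell_cost p \<sigma>)) (write_cell p 1 \<sigma>)"
| RCopy: "rexec (RCopy p q) \<sigma> 0 (Suc (cell_cost p \<sigma> + cell_cost q \<sigma>))
            (write_cell p (read_cell q \<sigma>) \<sigma>)"
| ROp: "rexec (ROp g p q q') \<sigma> 1 (Suc (cell_cost p \<sigma> + cell_cost q \<sigma> + cell_cost q' \<sigma>))
          (write_cell p (ring_eval g (read_cell q \<sigma>) (read_cell q' \<sigma>)) \<sigma>)"
| RSeq: "rexec c \<sigma> r t \<sigma>' \<Longrightarrow> rexec d \<sigma>' q u \<sigma>'' \<Longrightarrow> rexec (RSeq c d) \<sigma> (r + q) (t + u) \<sigma>''"
| RIfTrue: "eval e (fst \<sigma>) \<noteq> 0 \<Longrightarrow> rexec c \<sigma> r t \<sigma>' \<Longrightarrow>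
    rexec (RIf e c d) \<sigma> r (Suc (eval_cost e (fst \<sigma>) + t)) \<sigma>'"
| RIfFalse: "eval e (fst \<sigma>) = 0 \<Longrightarrow> rexec d \<sigma> r t \<sigma>' \<Longrightarrow>
    rexec (RIf e c d) \<sigma> r (Suc (eval_cost e (fst \<sigma>) + t)) \<sigma>'"
| RWhileFalse: "eval e (fst \<sigma>) = 0 \<Longrightarrow> rexec (RWhile e c) \<sigma> 0 (Suc (eval_cost e (fst \<sigma>))) \<sigma>"
| RWhileTrue: "eval e (fst \<sigma>) \<noteq> 0 \<Longrightarrow> rexec c \<sigma> r t \<sigma>' \<Longrightarrow> rexec (RWhile e c) \<sigma>' q u \<sigma>'' \<Longrightarrow>
    rexec (RWhile e c) \<sigma> (r + q) (Suc (eval_cost e (fst \<sigma>) + t + u)) \<sigma>''"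


section \<open>Efficiently listable families\<close>

text \<open>
  Running times such as \<open>|F| |U|^O(1)\<close> are asymptotic, so they are properties of a collection
  of set systems \<open>(U, F)\<close> handled by one algorithm with one choice of constants; a single
  set system is the special case of a singleton collection. The ground set is enumerated by a list,
  which fixes the correspondence between subsets and bitstrings. The algorithms receive
  \<open>|U|\<close> and a description of the set system; the description is an arbitrary list of numbers,
  and may be empty.
\<close>

record 'u set_system =
  ground :: "'u list"
  family :: "'u set set"
  description :: "nat list"

abbreviation universe :: "'u set_system \<Rightarrow> 'u set" where
  "universe I \<equiv> set (ground I)"

definition bitstring :: "'u set_system \<Rightarrow> 'u set \<Rightarrow> bool list" where
  "bitstring I S = map (\<lambda>u. u \<in> S) (ground I)"

text \<open>The position, counted from zero, of \<open>S\<close> in the sorted (lexicographic, with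
  \<open>False < True\<close>) list of the bitstrings of the members of the family.\<close>

definition rank :: "'u set_system \<Rightarrow> 'u set \<Rightarrow> nat" where
  "rank I S = card {T \<in> family I. bitstring I T < bitstring I S}"

definition start_store :: "'u set_system \<Rightarrow> nat \<Rightarrow> store" where
  "start_store I k =
     \<lparr>scal = (\<lambda>_. 0)(0 := length (ground I), 1 := length (description I), 2 := k),
      arr = (\<lambda>_ _. 0)(0 := (\<lambda>j. if j < length (description I) then description I ! j else 0))\<rparr>"

definition outputs_listing :: "'u set_system \<Rightarrow> store \<Rightarrow> bool" where
  "outputs_listing I s \<longleftrightarrow>
     scal s 0 = card (family I) \<and>
     (\<forall>S\<in>family I. \<forall>i<length (ground I).
        arr s 1 (rank I S * length (ground I) + i) = of_bool (bitstring I S ! i))"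

definition efficiently_listable :: "'u set_system set \<Rightarrow> bool" where
  "efficiently_listable \<I> \<longleftrightarrow>
     (\<exists>L c d. \<forall>I\<in>\<I>. \<exists>t s. exec L (start_store I 0) t s \<and> outputs_listing I s \<and>
        t \<le> c * (card (family I) * card (universe I) ^ d))"


section \<open>Tables in memory\<close>

text \<open>A table indexed by \<open>k\<close>-tuples of members of the family is laid out as an array, the
  index of a tuple being the number with base-\<open>|F|\<close> digits \<open>rank (f 1), \<dots>, rank (f k)\<close>, least
  significant digit first.\<close>

definition tuple_index :: "'u set_system \<Rightarrow> nat \<Rightarrow> (nat \<Rightarrow> 'u set) \<Rightarrow> nat" where
  "tuple_index I k f = (\<Sum>i = 1..k. rank I (f i) * card (family I) ^ (i - 1))"

definition holds_table ::
  "'u set_system \<Rightarrow> nat \<Rightarrow> (nat \<Rightarrow> 'r) \<Rightarrow> ((nat \<Rightarrow> 'u set) \<Rightarrow> 'r) \<Rightarrow> bool" where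
  "holds_table I k m A \<longleftrightarrow> (\<forall>f\<in>tuples (family I) k. m (tuple_index I k f) = A f)"

text \<open>\<open>P\<close> finds the input tables in the ring arrays \<open>0\<close> and \<open>1\<close> and leaves their product in the
  ring array \<open>2\<close>. The other ring cells initially hold arbitrary values.\<close>

definition computes_comp_cover ::
  "rcom \<Rightarrow> 'u set_system \<Rightarrow> nat \<Rightarrow> ((nat \<Rightarrow> 'u set) \<Rightarrow> 'r::{comm_ring,comm_monoid_mult}) \<Rightarrow> ((nat \<Rightarrow> 'u set) \<Rightarrow> 'r)
     \<Rightarrow> nat \<Rightarrow> nat \<Rightarrow> bool" where
  "computes_comp_cover P I k A B max_ops max_time \<longleftrightarrow>
     (\<forall>m. holds_table I k (m 0) A \<and> holds_table I k (m 1) B \<longrightarrow>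
        (\<exists>r t s m'. rexec P (start_store I k, m) r t (s, m') \<and>
           holds_table I k (m' 2) (comp_cover_product (family I) k A B) \<and>
           r \<le> max_ops \<and> t \<le> max_time))"

end

theory Submission
  imports Defs
begin

text \<open>A closure difference is convex: it contains every set between two of its members. Hence the
  zeta transform on \<open>F^k\<close> can be computed coordinate by coordinate without leaving \<open>F^k\<close>: for
  every coordinate \<open>(i, u)\<close>, add to the entry at \<open>f\<close> the entry at \<open>f(i := f i - {u})\<close> whenever the
  latter set is a member. The transform turns the cover product into the pointwise product, because
  the componentwise union of two tuples below \<open>f\<close> is again in \<open>F^k\<close>, and it is undone by the
  corresponding subtractions. This takes \<open>O(k |U|)\<close> passes over tables of size \<open>|F|^k\<close>. On the machine,
  the rank of \<open>f i - {u}\<close> is found in a sparse array indexed by the numbers whose binary digits are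
  the bitstrings of the members; it occupies only \<open>|F|\<close> cells, and an index has \<open>|U|\<close> bits.\<close>

section \<open>Program logic with cost bounds\<close>

text \<open>The obstacle beyond the algebra is uniformity and bit cost. One program has to serve
  every set system of the collection, every \<open>k\<close> and every pair of tables, and it may
  use the listing program \<open>L\<close> only as a black box, known on start stores with parameter
  0 alone. So \<open>k\<close> and \<open>|U|\<close> must survive the run of \<open>L\<close> in
  registers that \<open>L\<close> never names, and the lookup array must be one that
  \<open>L\<close> leaves zero; hence the syntactic bounds on names. Since time is logarithmic cost,
  operations are counted and the count is multiplied by the squared length of one number
  \<open>V\<close> that dominates all values outside \<open>L\<close>; \<open>V\<close> has O(k |U|)
  bits, so this costs a factor of order (k |U|)^2. The transforms run in place: in the pass for
  \<open>(i, u)\<close> the only other entry read at a tuple belongs to one whose component lacks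
  \<open>u\<close>, and the pass does not change such entries, so the order of visits within a pass
  does not matter.\<close>

lemma exec_time_pos: "exec c s t s' \<Longrightarrow> 0 < t"
  by (induction rule: exec.induct) auto

text \<open>Registers and arrays share one bound because the same number \<open>h\<close> is later
  used both as a register and as an array.\<close>

primrec exp_bound :: "exp \<Rightarrow> nat" where
  "exp_bound (Num n) = 0"
| "exp_bound (Var x) = Suc x"
| "exp_bound (Get a e) = max (Suc a) (exp_bound e)"
| "exp_bound (Add e f) = max (exp_bound e) (exp_bound f)"
| "exp_bound (Sub e f) = max (exp_bound e) (exp_bound f)"
| "exp_bound (Mul e f) = max (exp_bound e) (exp_bound f)"
| "exp_bound (Div e f) = max (exp_bound e) (exp_bound f)"

primrec com_bound :: "com \<Rightarrow> nat" where
  "com_bound (Assign x e) = max (Suc x) (exp_bound e)"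
| "com_bound (Put a e f) = max (Suc a) (max (exp_bound e) (exp_bound f))"
| "com_bound (Seq c d) = max (com_bound c) (com_bound d)"
| "com_bound (If e c d) = max (exp_bound e) (max (com_bound c) (com_bound d))"
| "com_bound (While e c) = max (exp_bound e) (com_bound c)"

abbreviation set_scal :: "nat \<Rightarrow> nat \<Rightarrow> store \<Rightarrow> store" where
  "set_scal x v s \<equiv> s\<lparr>scal := (scal s)(x := v)\<rparr>"

lemma eval_fresh:
  assumes "exp_bound e \<le> x"
  shows "eval e (set_scal x v s) = eval e s" "eval_cost e (set_scal x v s) = eval_cost e s"
proof -
  have "eval e (set_scal x v s) = eval e s \<and> eval_cost e (set_scal x v s) = eval_cost e s"
    using assms by (induction e) auto
  then show "eval e (set_scal x v s) = eval e s" "eval_cost e (set_scal x v s) = eval_cost e s"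
    by auto
qed

text \<open>Protects the values parked in registers \<open>h\<close> and \<open>Suc h\<close> while
  \<open>L\<close> runs: neither control flow nor cost can depend on a register that the program
  never names.\<close>

lemma exec_scal_fresh:
  "exec c s t s' \<Longrightarrow> com_bound c \<le> x \<Longrightarrow> exec c (set_scal x v s) t (set_scal x v s')"
proof (induction rule: exec.induct)
  case (Assign y e s)
  then have bounds: "y \<noteq> x" "exp_bound e \<le> x" by auto
  have "exec (Assign y e) (set_scal x v s) (Suc (eval_cost e (set_scal x v s)))
      (set_scal y (eval e (set_scal x v s)) (set_scal x v s))"
    using exec.Assign[of y e "set_scal x v s"] by simp
  moreover have "set_scal y (eval e s) (set_scal x v s) = set_scal x v (set_scal y (eval e s) s)"
    using bounds by (simp add: fun_upd_twist)
  ultimately show ?case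
    by (simp only: eval_fresh[OF bounds(2)])
next
  case (Put a e f s)
  let ?A = "(arr s)(a := (arr s a)(eval e s := eval f s))"
  have "set_scal x v (s\<lparr>arr := ?A\<rparr>) = (set_scal x v s)\<lparr>arr := ?A\<rparr>"
    by simp
  moreover have arr_eq: "arr (set_scal x v s) = arr s"
    by simp
  ultimately show ?case
    using Put exec.Put[of a e f "set_scal x v s"]
    by (simp only: eval_fresh com_bound.simps max.bounded_iff arr_eq)
next
  case (Seq c s t s' d u s'')
  then show ?case by (auto intro: exec.Seq)
next
  case (IfTrue e s c t s' d)
  then show ?case
    using exec.IfTrue[of e "set_scal x v s" c t "set_scal x v s'" d] by (simp add: eval_fresh del: fun_upd_apply)
next
  case (IfFalse e s d t s' c)
  then show ?case
    using exec.IfFalse[of e "set_scal x v s" d t "set_scal x v s'" c] by (simp add: eval_fresh del: fun_upd_apply)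
next
  case (WhileFalse e s c)
  then show ?case
    using exec.WhileFalse[of e "set_scal x v s" c] by (simp add: eval_fresh del: fun_upd_apply)
next
  case (WhileTrue e s c t s' u s'')
  then show ?case
    using exec.WhileTrue[of e "set_scal x v s" c t "set_scal x v s'" u "set_scal x v s''"]
    by (simp add: eval_fresh del: fun_upd_apply)
qed

text \<open>Ensures that the lookup array \<open>h\<close> is still zero after \<open>L\<close>, so
  that codes of non-members need no clearing.\<close>

lemma exec_arr_fresh: "exec c s t s' \<Longrightarrow> com_bound c \<le> a \<Longrightarrow> arr s' a = arr s a"
  by (induction rule: exec.induct) auto

section \<open>Operation counts, and the size condition that turns them into bit costs\<close>

primrec exp_ops :: "exp \<Rightarrow> nat" where
  "exp_ops (Num n) = 1"
| "exp_ops (Var x) = 1"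
| "exp_ops (Get a e) = Suc (exp_ops e)"
| "exp_ops (Add e f) = Suc (exp_ops e + exp_ops f)"
| "exp_ops (Sub e f) = Suc (exp_ops e + exp_ops f)"
| "exp_ops (Mul e f) = Suc (exp_ops e + exp_ops f)"
| "exp_ops (Div e f) = Suc (exp_ops e + exp_ops f)"

text \<open>Truncated subtraction and division never exceed their first operand, so the bound is
  tested only at constants, stored values, sums and products.\<close>

primrec fits :: "nat \<Rightarrow> exp \<Rightarrow> store \<Rightarrow> bool" where
  "fits V (Num n) s \<longleftrightarrow> n \<le> V"
| "fits V (Var x) s \<longleftrightarrow> scal s x \<le> V"
| "fits V (Get a e) s \<longleftrightarrow> fits V e s \<and> arr s a (eval e s) \<le> V"
| "fits V (Add e f) s \<longleftrightarrow> fits V e s \<and> fits V f s \<and> eval e s + eval f s \<le> V"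
| "fits V (Sub e f) s \<longleftrightarrow> fits V e s \<and> fits V f s"
| "fits V (Mul e f) s \<longleftrightarrow> fits V e s \<and> fits V f s \<and> eval e s * eval f s \<le> V"
| "fits V (Div e f) s \<longleftrightarrow> fits V e s \<and> fits V f s"

lemma bit_length_mono: "a \<le> b \<Longrightarrow> bit_length a \<le> bit_length b"
  by (simp add: bit_length_def floor_log_le_iff)

lemma bit_length_le_square: "a \<le> b \<Longrightarrow> bit_length a \<le> (bit_length b)\<^sup>2"
proof -
  assume "a \<le> b"
  then have "bit_length a \<le> bit_length b * 1" using bit_length_mono by simp
  also have "\<dots> \<le> bit_length b * bit_length b"
    by (intro mult_le_mono) (auto simp: bit_length_def)
  finally show ?thesis by (simp add: power2_eq_square)
qed

lemma bit_length_mult_le_square: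
  "a \<le> c \<Longrightarrow> b \<le> c \<Longrightarrow> bit_length a * bit_length b \<le> (bit_length c)\<^sup>2"
  by (simp add: power2_eq_square bit_length_mono mult_le_mono)

lemma fits_eval_cost:
  "fits V e s \<Longrightarrow> eval e s \<le> V \<and> eval_cost e s \<le> exp_ops e * (bit_length V)\<^sup>2"
proof (induction e)
  case (Get a e)
  then show ?case
    using bit_length_le_square[of "arr s a (eval e s)" V] by auto
next
  case (Add e f)
  then show ?case
    using bit_length_le_square[of "eval e s + eval f s" V] by (auto simp: algebra_simps)
next
  case (Sub e f)
  then show ?case
    using bit_length_le_square[of "eval e s - eval f s" V] le_trans[OF diff_le_self]
    by (fastforce simp: add_mult_distrib)
next
  case (Mul e f)
  then show ?case
    using bit_length_mult_le_square[of "eval e s" V "eval f s"] by (auto simp: algebra_simps)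
next
  case (Div e f)
  then show ?case
    using bit_length_mult_le_square[of "eval e s" V "eval f s"]
      order.trans[OF div_le_dividend[of "eval e s" "eval f s"]] by (auto simp: algebra_simps)
qed (auto intro: bit_length_le_square)

text \<open>Time is measured in units of the squared length of the largest number \<open>V\<close> that may
  occur, which bounds the cost of a single arithmetic operation.\<close>

definition wp ::
  "nat \<Rightarrow> rcom \<Rightarrow> nat \<Rightarrow> nat \<Rightarrow> ('r::{comm_ring,comm_monoid_mult} config \<Rightarrow> bool) \<Rightarrow> 'r config \<Rightarrow> bool" where
  "wp V c r t Q \<sigma> \<longleftrightarrow>
     (\<exists>r' t' \<sigma>'. rexec c \<sigma> r' t' \<sigma>' \<and> r' \<le> r \<and> t' \<le> t * (bit_length V)\<^sup>2 \<and> Q \<sigma>')"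

lemma wp_mono:
  assumes "wp V c r t Q \<sigma>" "r \<le> r'" "t \<le> t'" "\<And>s m. Q (s, m) \<Longrightarrow> Q' (s, m)"
  shows "wp V c r' t' Q' \<sigma>"
proof -
  obtain r0 t0 \<sigma>' where *: "rexec c \<sigma> r0 t0 \<sigma>'" "r0 \<le> r" "t0 \<le> t * (bit_length V)\<^sup>2" "Q \<sigma>'"
    using assms(1) unfolding wp_def by blast
  moreover have "t * (bit_length V)\<^sup>2 \<le> t' * (bit_length V)\<^sup>2"
    using assms(3) by simp
  ultimately show ?thesis
    unfolding wp_def using assms(2,4) by (cases \<sigma>') (meson le_trans)
qed

lemma wp_Seq:
  assumes "wp V c r t (wp V d q u Q) \<sigma>"
  shows "wp V (RSeq c d) (r + q) (t + u) Q \<sigma>"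
proof -
  obtain r1 t1 \<sigma>1 where 1: "rexec c \<sigma> r1 t1 \<sigma>1" "r1 \<le> r" "t1 \<le> t * (bit_length V)\<^sup>2"
    "wp V d q u Q \<sigma>1"
    using assms unfolding wp_def by blast
  then obtain r2 t2 \<sigma>2 where 2: "rexec d \<sigma>1 r2 t2 \<sigma>2" "r2 \<le> q" "t2 \<le> u * (bit_length V)\<^sup>2"
    "Q \<sigma>2"
    unfolding wp_def by blast
  have "rexec (RSeq c d) \<sigma> (r1 + r2) (t1 + t2) \<sigma>2"
    using 1 2 by (auto intro: rexec.RSeq)
  with 1 2 show ?thesis
    unfolding wp_def by (metis add_mono add_mult_distrib)
qed

lemma one_le_bit_length_square: "1 \<le> (bit_length V)\<^sup>2"
  by (simp add: bit_length_def)

text \<open>\<open>L\<close> may handle numbers larger than \<open>V\<close>, so its measured time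
  itself is entered as the count; the factor of at least 1 only weakens the bound.\<close>

lemma wp_exec:
  assumes "exec c s t s'" "Q (s', m)"
  shows "wp V (Plain c) 0 t Q (s, m)"
  unfolding wp_def
  using assms rexec.Plain[OF assms(1), of m] one_le_bit_length_square[of V] by fastforce

lemma wp_Assign:
  assumes "fits V e s" "Q (set_scal x (eval e s) s, m)"
  shows "wp V (Plain (Assign x e)) 0 (Suc (exp_ops e)) Q (s, m)"
  unfolding wp_def
  using assms rexec.Plain[OF exec.Assign[of x e s], of m] fits_eval_cost[OF assms(1)]
    one_le_bit_length_square[of V]
  by (intro exI[of _ 0] exI[of _ "Suc (eval_cost e s)"] exI conjI) auto

text \<open>Lets the assigned value be named by its mathematical meaning, so that later stores carry
  no unevaluated expressions.\<close>

lemma wp_Assign_value: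
  assumes "fits V e s" "eval e s = v" "Q (set_scal x v s, m)"
  shows "wp V (Plain (Assign x e)) 0 (Suc (exp_ops e)) Q (s, m)"
  using assms wp_Assign[of V e s Q x m] by simp

lemma wp_Put:
  assumes "fits V e s" "fits V f s"
    "Q (s\<lparr>arr := (arr s)(a := (arr s a)(eval e s := eval f s))\<rparr>, m)"
  shows "wp V (Plain (Put a e f)) 0 (Suc (exp_ops e + exp_ops f)) Q (s, m)"
  unfolding wp_def
  using assms rexec.Plain[OF exec.Put[of a e f s], of m] fits_eval_cost[OF assms(1)]
    fits_eval_cost[OF assms(2)] one_le_bit_length_square[of V]
  by (intro exI[of _ 0] exI[of _ "Suc (eval_cost e s + eval_cost f s)"] exI conjI)
    (auto simp: algebra_simps)

lemma wp_ROp: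
  assumes "fits V e1 s" "fits V e2 s" "fits V e3 s"
    "Q (s, m(a1 := (m a1)(eval e1 s := ring_eval g (m a2 (eval e2 s)) (m a3 (eval e3 s)))))"
  shows "wp V (ROp g (a1, e1) (a2, e2) (a3, e3)) 1
           (Suc (exp_ops e1 + exp_ops e2 + exp_ops e3)) Q (s, m)"
  unfolding wp_def
proof (intro exI conjI)
  show "rexec (ROp g (a1, e1) (a2, e2) (a3, e3)) (s, m) 1
      (Suc (cell_cost (a1, e1) (s, m) + cell_cost (a2, e2) (s, m) + cell_cost (a3, e3) (s, m)))
      (write_cell (a1, e1) (ring_eval g (read_cell (a2, e2) (s, m)) (read_cell (a3, e3) (s, m)))
        (s, m))"
    by (rule rexec.ROp)
  show "Suc (cell_cost (a1, e1) (s, m) + cell_cost (a2, e2) (s, m) + cell_cost (a3, e3) (s, m))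
    \<le> Suc (exp_ops e1 + exp_ops e2 + exp_ops e3) * (bit_length V)\<^sup>2"
    using fits_eval_cost[OF assms(1)] fits_eval_cost[OF assms(2)] fits_eval_cost[OF assms(3)]
      one_le_bit_length_square[of V]
    by (simp add: cell_cost_def algebra_simps)
qed (use assms in \<open>auto simp: write_cell_def read_cell_def\<close>)

lemma wp_If:
  assumes "fits V e s"
    "eval e s \<noteq> 0 \<Longrightarrow> wp V c r t Q (s, m)"
    "eval e s = 0 \<Longrightarrow> wp V d r t Q (s, m)"
  shows "wp V (RIf e c d) r (Suc (exp_ops e + t)) Q (s, m)"
proof -
  define b where "b = (if eval e s \<noteq> 0 then c else d)"
  have "wp V b r t Q (s, m)"
    using assms by (simp add: b_def)
  then obtain r' t' \<sigma>' where *: "rexec b (s, m) r' t' \<sigma>'" "r' \<le> r"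
    "t' \<le> t * (bit_length V)\<^sup>2" "Q \<sigma>'"
    unfolding wp_def by blast
  have "rexec (RIf e c d) (s, m) r' (Suc (eval_cost e s + t')) \<sigma>'"
    using * rexec.RIfTrue[of e "(s, m)" c r' t' \<sigma>' d] rexec.RIfFalse[of e "(s, m)" d r' t' \<sigma>' c]
    by (auto simp: b_def split: if_splits)
  then show ?thesis
    unfolding wp_def
    using * fits_eval_cost[OF assms(1)] one_le_bit_length_square[of V]
    by (intro exI[of _ r'] exI[of _ "Suc (eval_cost e s + t')"] exI conjI)
      (auto simp: algebra_simps)
qed

definition rfor :: "nat \<Rightarrow> nat \<Rightarrow> rcom \<Rightarrow> rcom" where
  "rfor x y c = RSeq (Plain (Assign x (Num 0)))
     (RWhile (Sub (Var y) (Var x)) (RSeq c (Plain (Assign x (Add (Var x) (Num 1))))))"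

text \<open>The increment belongs to the loop and not to \<open>c\<close>, so the body must
  establish the invariant for the store with the counter already advanced. Of the 8 extra units per
  round, 4 pay for the test and 4 for the increment; the final 6 are the initial assignment and the
  failing test.\<close>

lemma wp_for:
  assumes "x \<noteq> y" "n \<le> V" "scal s y = n" "Inv 0 (set_scal x 0 s) m"
    and step: "\<And>i s m. i < n \<Longrightarrow> scal s x = i \<Longrightarrow> scal s y = n \<Longrightarrow> Inv i s m \<Longrightarrow>
      wp V c r t (\<lambda>(s, m). scal s x = i \<and> scal s y = n \<and> Inv (Suc i) (set_scal x (Suc i) s) m) (s, m)"
    and final: "\<And>s m. Inv n s m \<Longrightarrow> Q (s, m)"
  shows "wp V (rfor x y c) (n * r) (n * (t + 8) + 6) Q (s, m)"
proof -
  let ?W = "RWhile (Sub (Var y) (Var x)) (RSeq c (Plain (Assign x (Add (Var x) (Num 1)))))"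
  \<comment> \<open>Induction on the number \<open>d\<close> of rounds still to run, with the
    counter at \<open>n - d\<close>.\<close>
  have loop: "wp V ?W (d * r) (d * (t + 8) + 4) Q (s, m)"
    if "d \<le> n" "scal s x = n - d" "scal s y = n" "Inv (n - d) s m" for d s m
    using that
  proof (induction d arbitrary: s m)
    case 0
    have "fits V (Sub (Var y) (Var x)) s" using 0 assms(2) by simp
    from fits_eval_cost[OF this]
    have "Suc (eval_cost (Sub (Var y) (Var x)) s) \<le> 4 * (bit_length V)\<^sup>2"
      using one_le_bit_length_square[of V] by simp
    moreover have "rexec ?W (s, m) 0 (Suc (eval_cost (Sub (Var y) (Var x)) (fst (s, m)))) (s, m)"
      using 0 by (intro rexec.RWhileFalse) simp
    ultimately show ?case
      unfolding wp_def using final[of s m] 0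
      by (intro exI[of _ 0] exI[of _ "Suc (eval_cost (Sub (Var y) (Var x)) s)"] exI[of _ "(s, m)"]
          conjI) auto
  next
    case (Suc d)
    let ?i = "n - Suc d"
    let ?body = "RSeq c (Plain (Assign x (Add (Var x) (Num 1))))"
    have i: "?i < n" "Suc ?i = n - d" using Suc.prems by auto
    have bnd: "?i \<le> V" "Suc 0 \<le> V" "n - d \<le> V" using Suc.prems(1) assms(2) by arith+
    let ?R = "wp V ?W (d * r) (d * (t + 8) + 4) Q"
    have "wp V ?body (r + 0) (t + Suc (exp_ops (Add (Var x) (Num 1)))) ?R (s, m)"
    proof (rule wp_Seq, rule wp_mono)
      show "wp V c r t (\<lambda>(s, m). scal s x = ?i \<and> scal s y = n \<and>
          Inv (Suc ?i) (set_scal x (Suc ?i) s) m) (s, m)"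
        by (rule step[OF i(1) Suc.prems(2-4)])
      fix s' m'
      assume "case (s', m') of (s, m) \<Rightarrow> scal s x = ?i \<and> scal s y = n \<and>
        Inv (Suc ?i) (set_scal x (Suc ?i) s) m"
      then have *: "scal s' x = ?i" "scal s' y = n" "Inv (n - d) (set_scal x (n - d) s') m'"
        using i(2) by simp_all
      have "?R (set_scal x (n - d) s', m')"
        by (rule Suc.IH) (use * assms(1) Suc.prems(1) in simp_all)
      then show "wp V (Plain (Assign x (Add (Var x) (Num 1)))) 0
          (Suc (exp_ops (Add (Var x) (Num 1)))) ?R (s', m')"
        using i(2) bnd * by (intro wp_Assign) simp_all
    qed simp_all
    then have "wp V ?body r (t + 4) ?R (s, m)"
      by (rule wp_mono) simp_all
    then obtain r1 t1 \<sigma>1 where 1: "rexec ?body (s, m) r1 t1 \<sigma>1" "r1 \<le> r"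
      "t1 \<le> (t + 4) * (bit_length V)\<^sup>2" "wp V ?W (d * r) (d * (t + 8) + 4) Q \<sigma>1"
      unfolding wp_def[of _ ?body] by blast
    then obtain r2 t2 \<sigma>2 where 2: "rexec ?W \<sigma>1 r2 t2 \<sigma>2" "r2 \<le> d * r"
      "t2 \<le> (d * (t + 8) + 4) * (bit_length V)\<^sup>2" "Q \<sigma>2"
      unfolding wp_def[of _ ?W] by blast
    have "rexec ?W (s, m) (r1 + r2)
        (Suc (eval_cost (Sub (Var y) (Var x)) (fst (s, m)) + t1 + t2)) \<sigma>2"
      using Suc.prems 1 2 by (intro rexec.RWhileTrue) auto
    moreover have "fits V (Sub (Var y) (Var x)) s" using Suc.prems assms(2) by simp
    from fits_eval_cost[OF this]
    have "Suc (eval_cost (Sub (Var y) (Var x)) s) \<le> 4 * (bit_length V)\<^sup>2"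
      using one_le_bit_length_square[of V] by simp
    then have "Suc (eval_cost (Sub (Var y) (Var x)) s + t1 + t2)
        \<le> (Suc d * (t + 8) + 4) * (bit_length V)\<^sup>2"
      using 1 2 by (simp add: algebra_simps)
    ultimately show ?case
      unfolding wp_def using 1 2
      by (intro exI[of _ "r1 + r2"]
          exI[of _ "Suc (eval_cost (Sub (Var y) (Var x)) s + t1 + t2)"] exI[of _ "\<sigma>2"] conjI) auto
  qed
  have "wp V (rfor x y c) (0 + n * r) (Suc (exp_ops (Num 0)) + (n * (t + 8) + 4)) Q (s, m)"
    unfolding rfor_def
    using assms(1-4) by (intro wp_Seq wp_Assign loop) simp_all
  then show ?thesis by (simp add: ac_simps)
qed

section \<open>The zeta transform on tuples over a convex family\<close>

text \<open>Up-closures are inherited upwards: \<open>X\<close> gets its witness in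
  \<open>Fp\<close> from \<open>S\<close>, and a member of \<open>Fm\<close> inside \<open>X\<close>
  would also lie inside \<open>T\<close>.\<close>

lemma closure_difference_convex:
  assumes "closure_difference U F" "S \<in> F" "T \<in> F" "S \<subseteq> X" "X \<subseteq> T"
  shows "X \<in> F"
proof -
  obtain Fp Fm where F: "F = up_closure U Fp - up_closure U Fm"
    using assms(1) unfolding closure_difference_def by blast
  obtain Y where Y: "Y \<in> Fp" "Y \<subseteq> S"
    using assms(2) unfolding F up_closure_def mem_Collect_eq Diff_iff by blast
  have T: "T \<subseteq> U" "\<not> (\<exists>Y\<in>Fm. Y \<subseteq> T)"
    using assms(3) unfolding F up_closure_def mem_Collect_eq Diff_iff by blast+
  have "X \<subseteq> U"
    using assms(5) T(1) by (rule subset_trans)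
  moreover have "\<exists>Y\<in>Fp. Y \<subseteq> X"
    using Y(1) subset_trans[OF Y(2) assms(4)] by (rule bexI[rotated])
  moreover have "\<not> (\<exists>Y\<in>Fm. Y \<subseteq> X)"
    using T(2) subset_trans[OF _ assms(5)] by auto
  ultimately show ?thesis
    unfolding F up_closure_def by simp
qed

locale set_family =
  fixes U :: "'u set" and F :: "'u set set"
  assumes finite_ground: "finite U"
    and family_subset: "F \<subseteq> Pow U"
    and convex: "S \<in> F \<Longrightarrow> T \<in> F \<Longrightarrow> S \<subseteq> X \<Longrightarrow> X \<subseteq> T \<Longrightarrow> X \<in> F"
begin

lemma finite_family: "finite F"
  using finite_subset[OF family_subset] finite_ground by simp

lemma finite_tuples: "finite (tuples F k)"
  unfolding tuples_def by (intro finite_PiE) (simp_all add: finite_family)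

lemma tuples_mem: "f \<in> tuples F k \<Longrightarrow> i \<in> {1..k} \<Longrightarrow> f i \<in> F"
  unfolding tuples_def by (rule PiE_mem)

lemma tuples_upd: "f \<in> tuples F k \<Longrightarrow> i \<in> {1..k} \<Longrightarrow> S \<in> F \<Longrightarrow> f(i := S) \<in> tuples F k"
  unfolding tuples_def using PiE_fun_upd[of S "\<lambda>_. F" i f "{1..k}"] by (simp add: insert_absorb)

text \<open>\<open>P\<close> says which elements may be deleted from which component. For
  \<open>f\<close> in \<open>F^k\<close>, an empty \<open>P\<close> leaves only \<open>f\<close>,
  and the full \<open>P\<close> gives every tuple of \<open>F^k\<close> below
  \<open>f\<close>.\<close>

definition zeta_range :: "nat \<Rightarrow> (nat \<times> 'u) set \<Rightarrow> (nat \<Rightarrow> 'u set) \<Rightarrow> (nat \<Rightarrow> 'u set) set" where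
  "zeta_range k P f =
     {g \<in> tuples F k. \<forall>i\<in>{1..k}. g i \<subseteq> f i \<and> (\<forall>u\<in>f i - g i. (i, u) \<in> P)}"

text \<open>The zeta transform with respect to those coordinates \<open>(i, u)\<close> only that lie in \<open>P\<close>.\<close>

definition zeta ::
  "nat \<Rightarrow> (nat \<times> 'u) set \<Rightarrow> ((nat \<Rightarrow> 'u set) \<Rightarrow> 'r::{comm_ring,comm_monoid_mult}) \<Rightarrow> (nat \<Rightarrow> 'u set) \<Rightarrow> 'r" where
  "zeta k P A f = (\<Sum>g\<in>zeta_range k P f. A g)"

lemma zeta_empty:
  assumes "f \<in> tuples F k"
  shows "zeta k {} A f = A f"
proof -
  have "zeta_range k {} f = {f}"
  proof (intro equalityI subsetI)
    fix g assume "g \<in> zeta_range k {} f"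
    then have "g \<in> tuples F k" "\<And>i. i \<in> {1..k} \<Longrightarrow> g i = f i"
      unfolding zeta_range_def by blast+
    then have "g = f"
      using assms unfolding tuples_def by (rule_tac PiE_ext)
    then show "g \<in> {f}" by simp
  qed (use assms in \<open>simp add: zeta_range_def\<close>)
  then show ?thesis by (simp add: zeta_def)
qed

text \<open>Convexity enters here: if \<open>f i - {u}\<close> is not in the family, then no member of the family
  below \<open>f i\<close> omits \<open>u\<close>.\<close>

lemma zeta_insert:
  assumes f: "f \<in> tuples F k" and i: "i \<in> {1..k}" and new: "(i, u) \<notin> P"
  shows "zeta k (insert (i, u) P) A f = zeta k P A f +
    (if u \<in> f i \<and> f i - {u} \<in> F then zeta k P A (f(i := f i - {u})) else 0)"
proof -
  let ?f' = "f(i := f i - {u})"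
  let ?D = "zeta_range k (insert (i, u) P) f \<inter> {g. u \<in> f i - g i}"
  have fin: "finite (zeta_range k Q g)" for Q g
    using finite_tuples by (simp add: zeta_range_def)
  \<comment> \<open>The new range is split by whether \<open>u\<close> is lost from component
    \<open>i\<close>; since \<open>(i, u)\<close> is not in \<open>P\<close>, no tuple of the old
    range loses it.\<close>
  have split: "zeta_range k (insert (i, u) P) f = zeta_range k P f \<union> ?D"
    using i by (auto simp: zeta_range_def)
  have disj: "zeta_range k P f \<inter> ?D = {}"
    using i new by (auto simp: zeta_range_def)
  have D: "?D = (if u \<in> f i \<and> f i - {u} \<in> F then zeta_range k P ?f' else {})"
  proof (cases "u \<in> f i \<and> f i - {u} \<in> F")
    case True
    have "g \<in> ?D \<longleftrightarrow> g \<in> zeta_range k P ?f'" for g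
      unfolding zeta_range_def using True i by (auto split: if_splits)
    with True show ?thesis by auto
  next
    case False
    have "g \<notin> ?D" for g
    proof
      assume "g \<in> ?D"
      then have "g i \<in> F" "g i \<subseteq> f i - {u}" "u \<in> f i"
        using i tuples_mem[of g k i] by (auto simp: zeta_range_def)
      then have "f i - {u} \<in> F"
        using convex[of "g i" "f i" "f i - {u}"] tuples_mem[OF f i] by auto
      with \<open>u \<in> f i\<close> False show False by simp
    qed
    with False show ?thesis by auto
  qed
  have "zeta k (insert (i, u) P) A f = sum A (zeta_range k P f) + sum A ?D"
    unfolding zeta_def using disj fin by (subst split) (intro sum.union_disjoint, auto)
  also have "sum A ?D = (if u \<in> f i \<and> f i - {u} \<in> F then zeta k P A ?f' else 0)"
    unfolding D zeta_def by simp
  finally show ?thesis by (simp add: zeta_def)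
qed

text \<open>Both sides sum \<open>A f1 * B f2\<close> over all pairs of tuples below
  \<open>f\<close>: the right side directly, the left side grouped by componentwise union.\<close>

lemma zeta_mult:
  assumes f: "f \<in> tuples F k"
  shows "zeta k ({1..k} \<times> U) (comp_cover_product F k A B) f =
    zeta k ({1..k} \<times> U) A f * zeta k ({1..k} \<times> U) B f"
proof -
  let ?Z = "zeta_range k ({1..k} \<times> U) f"
  let ?join = "\<lambda>(f1, f2). \<lambda>i\<in>{1..k}. (f1 i \<union> f2 i :: 'u set)"
  have Z: "?Z = {g \<in> tuples F k. \<forall>i\<in>{1..k}. g i \<subseteq> f i}"
    using tuples_mem[OF f] family_subset by (fastforce simp: zeta_range_def)
  have fin: "finite ?Z"
    unfolding Z by (simp add: finite_tuples)
  have join: "?join ` (?Z \<times> ?Z) \<subseteq> ?Z"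
  proof (rule image_subsetI)
    fix x assume "x \<in> ?Z \<times> ?Z"
    then obtain f1 f2 where x: "x = (f1, f2)" and *: "f1 \<in> ?Z" "f2 \<in> ?Z" by blast
    then have "f1 i \<union> f2 i \<in> F" if "i \<in> {1..k}" for i
      using that convex[of "f1 i" "f i" "f1 i \<union> f2 i"] tuples_mem[OF f that] tuples_mem[of f1 k i]
      unfolding Z by auto
    then show "?join x \<in> ?Z"
      using * unfolding Z x by (auto simp: tuples_def)
  qed
  have "zeta k ({1..k} \<times> U) (comp_cover_product F k A B) f =
      (\<Sum>h\<in>?Z. \<Sum>x | x \<in> ?Z \<times> ?Z \<and> ?join x = h. case x of (f1, f2) \<Rightarrow> A f1 * B f2)"
    unfolding zeta_def
  proof (rule sum.cong[OF refl])
    fix h assume h: "h \<in> ?Z"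
    have "{(f1, f2). f1 \<in> tuples F k \<and> f2 \<in> tuples F k \<and> (\<forall>i\<in>{1..k}. f1 i \<union> f2 i = h i)} =
        {x. x \<in> ?Z \<times> ?Z \<and> ?join x = h}"
    proof (rule set_eqI)
      fix x :: "(nat \<Rightarrow> 'u set) \<times> (nat \<Rightarrow> 'u set)"
      obtain f1 f2 where x: "x = (f1, f2)" by (cases x)
      \<comment> \<open>Outside \<open>{1..k}\<close> both \<open>h\<close> and the restricted join
        are undefined, so equality of the functions reduces to their components.\<close>
      have "h i = undefined" if "i \<notin> {1..k}" for i
        using h that unfolding Z tuples_def by (auto simp: PiE_iff extensional_def)
      then have "?join x = h \<longleftrightarrow> (\<forall>i\<in>{1..k}. f1 i \<union> f2 i = h i)"
        by (simp only: x case_prod_conv restrict_def fun_eq_iff) metis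
      then show "x \<in> {(f1, f2). f1 \<in> tuples F k \<and> f2 \<in> tuples F k \<and>
            (\<forall>i\<in>{1..k}. f1 i \<union> f2 i = h i)} \<longleftrightarrow>
          x \<in> {x. x \<in> ?Z \<times> ?Z \<and> ?join x = h}"
        using h unfolding Z x by (simp del: restrict_apply) blast
    qed
    then show "comp_cover_product F k A B h =
        (\<Sum>x | x \<in> ?Z \<times> ?Z \<and> ?join x = h. case x of (f1, f2) \<Rightarrow> A f1 * B f2)"
      by (simp add: comp_cover_product_def)
  qed
  \<comment> \<open>By \<open>join\<close> every union lands in \<open>?Z\<close>, so the fibres
    exhaust all pairs.\<close>
  also have "\<dots> = (\<Sum>(f1, f2)\<in>?Z \<times> ?Z. A f1 * B f2)"
    using fin join by (intro sum.group) auto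
  also have "\<dots> = zeta k ({1..k} \<times> U) A f * zeta k ({1..k} \<times> U) B f"
    by (simp add: zeta_def sum_product sum.cartesian_product)
  finally show ?thesis .
qed

end

section \<open>Ranks, codes and tuple indices\<close>

lemma digit_sum_less:
  fixes d :: "nat \<Rightarrow> nat"
  assumes "\<And>i. i < k \<Longrightarrow> d i < b"
  shows "(\<Sum>i<k. d i * b ^ i) < b ^ k"
  using assms
proof (induction k)
  case (Suc k)
  have "(\<Sum>i<Suc k. d i * b ^ i) < b ^ k + d k * b ^ k"
    using Suc by simp
  also have "\<dots> = Suc (d k) * b ^ k" by simp
  also have "\<dots> \<le> b * b ^ k"
    using Suc.prems[of k] by (intro mult_right_mono) auto
  finally show ?case by simp
qed simp

lemma digit_sum_digit:
  fixes d :: "nat \<Rightarrow> nat"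
  assumes "\<And>i. i < k \<Longrightarrow> d i < b" "i < k"
  shows "(\<Sum>i<k. d i * b ^ i) div b ^ i mod b = d i"
  using assms
proof (induction k)
  case (Suc k)
  have b: "b > 0" using Suc.prems(1)[of k] by simp
  show ?case
  proof (cases "i = k")
    case True
    then show ?thesis
      using digit_sum_less[of k d b] Suc.prems b by (simp add: div_mult_self1)
  next
    case False
    then have "i < k" using Suc.prems by simp
    \<comment> \<open>The top weight is a multiple of \<open>b * b ^ i\<close>; after division by
      \<open>b ^ i\<close> the top term therefore vanishes modulo \<open>b\<close>.\<close>
    then have "b ^ k = b * b ^ (k - Suc i) * b ^ i"
      by (metis Suc_diff_Suc diff_zero le_add_diff_inverse2 less_imp_le_nat mult.commute power_Suc
          power_add)
    then have "(\<Sum>i<Suc k. d i * b ^ i) =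
        (\<Sum>i<k. d i * b ^ i) + (b * (d k * b ^ (k - Suc i))) * b ^ i"
      by simp
    then have "(\<Sum>i<Suc k. d i * b ^ i) div b ^ i =
        b * (d k * b ^ (k - Suc i)) + (\<Sum>i<k. d i * b ^ i) div b ^ i"
      using b by (simp only:) (rule div_mult_self1, simp)
    then show ?thesis
      using Suc \<open>i < k\<close> by simp
  qed
qed simp

locale listed_family =
  fixes I :: "'u set_system"
  assumes distinct: "distinct (ground I)"
    and nonempty: "universe I \<noteq> {}"
    and subset: "family I \<subseteq> Pow (universe I)"
    and cd: "closure_difference (universe I) (family I)"
    and family_nonempty: "family I \<noteq> {}"

sublocale listed_family \<subseteq> set_family "universe I" "family I"
proof unfold_locales
  fix S T X assume "S \<in> family I" "T \<in> family I" "S \<subseteq> X" "X \<subseteq> T"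
  then show "X \<in> family I" by (rule closure_difference_convex[OF cd])
qed (simp_all add: subset)

context listed_family
begin

definition n :: nat where "n = length (ground I)"
definition F :: nat where "F = card (family I)"

lemma n_pos: "0 < n"
  using nonempty by (simp add: n_def)

lemma card_universe: "card (universe I) = n"
  by (simp add: n_def distinct distinct_card)

lemma F_pos: "0 < F"
  using family_nonempty finite_family by (simp add: F_def card_gt_0_iff)

lemma F_le: "F \<le> 2 ^ n"
  using card_mono[OF _ subset] by (simp add: F_def card_Pow card_universe)

lemma bitstring_inj:
  assumes "S \<subseteq> universe I" "T \<subseteq> universe I" "bitstring I S = bitstring I T"
  shows "S = T"
  using assms by (auto simp: bitstring_def)

lemma rank_less:
  assumes "S \<in> family I"
  shows "rank I S < F"
  unfolding rank_def F_def using assms finite_family by (intro psubset_card_mono) auto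

lemma rank_strict_mono:
  assumes "S \<in> family I" "bitstring I S < bitstring I T"
  shows "rank I S < rank I T"
  unfolding rank_def
proof (rule psubset_card_mono)
  show "finite {T' \<in> family I. bitstring I T' < bitstring I T}"
    using finite_family by simp
  show "{T' \<in> family I. bitstring I T' < bitstring I S} \<subset>
      {T' \<in> family I. bitstring I T' < bitstring I T}"
    using assms by (force intro: less_trans)
qed

lemma rank_inj: "inj_on (rank I) (family I)"
proof (rule inj_onI)
  fix S T assume *: "S \<in> family I" "T \<in> family I" "rank I S = rank I T"
  then have "bitstring I S = bitstring I T"
    using rank_strict_mono[of S T] rank_strict_mono[of T S] by (metis less_irrefl neq_iff)
  then show "S = T" using bitstring_inj * subset by blast
qed

text \<open>\<open>F\<close> distinct values below \<open>F\<close> exhaust the range, so a loop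
  over 0, ..., F - 1 meets every member exactly once.\<close>

lemma rank_image: "rank I ` family I = {..<F}"
proof (rule card_subset_eq)
  show "rank I ` family I \<subseteq> {..<F}"
    using rank_less by auto
  show "card (rank I ` family I) = card {..<F}"
    by (simp add: card_image[OF rank_inj] F_def)
qed simp

text \<open>Chosen so that deleting an element is a subtraction of a power of two. Position 0 has
  weight 1 here but is compared first in the lexicographic order, so codes are not ordered like
  ranks and arrays must translate between them.\<close>

definition code :: "'u set \<Rightarrow> nat" where
  "code S = (\<Sum>j<n. of_bool (ground I ! j \<in> S) * 2 ^ j)"

lemma code_less: "code S < 2 ^ n"
  unfolding code_def by (rule digit_sum_less) auto

lemma code_digit: "j < n \<Longrightarrow> code S div 2 ^ j mod 2 = of_bool (ground I ! j \<in> S)"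
  unfolding code_def by (rule digit_sum_digit) auto

lemma code_inj:
  assumes "S \<subseteq> universe I" "T \<subseteq> universe I" "code S = code T"
  shows "S = T"
proof -
  have "ground I ! j \<in> S \<longleftrightarrow> ground I ! j \<in> T" if "j < n" for j
    using code_digit[OF that, of S] code_digit[OF that, of T] assms(3)
    by (metis of_bool_eq_iff)
  then have "u \<in> S \<longleftrightarrow> u \<in> T" if "u \<in> universe I" for u
    using that by (metis in_set_conv_nth n_def)
  then show ?thesis using assms by auto
qed

text \<open>Distinctness of the ground list guarantees that deleting one element clears bit
  \<open>j\<close> and no other.\<close>

lemma code_remove:
  assumes "j < n" "ground I ! j \<in> S"
  shows "code S = code (S - {ground I ! j}) + 2 ^ j"
proof -
  have remove: "(of_bool (ground I ! i \<in> S - {ground I ! j}) :: nat) =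
      (if i = j then 0 else of_bool (ground I ! i \<in> S))" if "i < n" for i
    using that assms(1) distinct by (auto simp: n_def nth_eq_iff_index_eq)
  then have "code (S - {ground I ! j}) =
      (\<Sum>i<n. (if i = j then 0 else of_bool (ground I ! i \<in> S)) * 2 ^ i)"
    unfolding code_def by (intro sum.cong refl) (simp only: remove lessThan_iff)
  also have "\<dots> = (\<Sum>i\<in>{..<n} - {j}. of_bool (ground I ! i \<in> S) * 2 ^ i)"
    by (rule sum.mono_neutral_cong_right) auto
  finally show ?thesis
    unfolding code_def using assms by (subst sum.remove[of _ j]) auto
qed

section \<open>Numbering tuples by base-\<open>F\<close> digits\<close>

lemma tuple_index_eq: "tuple_index I k f = (\<Sum>i<k. rank I (f (Suc i)) * F ^ i)"
proof -
  have "{1..k} = Suc ` {..<k}" by (simp add: image_Suc_lessThan)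
  then show ?thesis
    unfolding tuple_index_def F_def by (simp add: sum.reindex)
qed

lemma tuple_rank_less:
  assumes "f \<in> tuples (family I) k" "i < k"
  shows "rank I (f (Suc i)) < F"
proof (rule rank_less)
  show "f (Suc i) \<in> family I"
    using tuples_mem[OF assms(1), of "Suc i"] assms(2) by simp
qed

lemma tuple_index_less:
  assumes "f \<in> tuples (family I) k"
  shows "tuple_index I k f < F ^ k"
  unfolding tuple_index_eq
  by (rule digit_sum_less[where d = "\<lambda>i. rank I (f (Suc i))"], rule tuple_rank_less[OF assms])

lemma tuple_index_digit:
  assumes "f \<in> tuples (family I) k" "i < k"
  shows "tuple_index I k f div F ^ i mod F = rank I (f (Suc i))"
  unfolding tuple_index_eq
  by (rule digit_sum_digit[where d = "\<lambda>i. rank I (f (Suc i))", OF _ assms(2)],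
      rule tuple_rank_less[OF assms(1)])

lemma tuple_index_inj: "inj_on (tuple_index I k) (tuples (family I) k)"
proof (rule inj_onI)
  fix f g assume *: "f \<in> tuples (family I) k" "g \<in> tuples (family I) k"
    "tuple_index I k f = tuple_index I k g"
  have "f (Suc i) = g (Suc i)" if "i < k" for i
  proof -
    have "rank I (f (Suc i)) = rank I (g (Suc i))"
      using tuple_index_digit[OF *(1) that] tuple_index_digit[OF *(2) that] *(3) by metis
    then show ?thesis
      using inj_onD[OF rank_inj] tuples_mem[OF *(1), of "Suc i"] tuples_mem[OF *(2), of "Suc i"] that
      by simp
  qed
  then have "f i = g i" if "i \<in> {1..k}" for i
    using that by (cases i) auto
  then show "f = g"
    using *(1,2) unfolding tuples_def by (rule_tac PiE_ext)
qed

lemma tuple_index_image: "tuple_index I k ` tuples (family I) k = {..<F ^ k}"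
proof (rule card_subset_eq)
  have "card (tuples (family I) k) = F ^ k"
    unfolding tuples_def F_def by (subst card_PiE) auto
  then show "card (tuple_index I k ` tuples (family I) k) = card {..<F ^ k}"
    by (simp add: card_image tuple_index_inj)
qed (use tuple_index_less in auto)

text \<open>Replacing a component exchanges a single digit; moving the old digit to the left side
  avoids truncated subtraction.\<close>

lemma tuple_index_upd:
  assumes "i < k"
  shows "tuple_index I k (f(Suc i := S)) + rank I (f (Suc i)) * F ^ i =
    tuple_index I k f + rank I S * F ^ i"
  unfolding tuple_index_eq using assms
  by (simp add: sum.remove[of "{..<k}" i])

end

section \<open>Programs and their correctness\<close>

text \<open>The language has no empty command; overwriting the scratch register 9 stands in for
  it.\<close>

definition skip :: rcom where
  "skip = Plain (Assign 9 (Num 0))"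

lemma wp_skip:
  assumes "2 \<le> t" "Q (set_scal 9 0 s, m)"
  shows "wp V skip r t Q (s, m)"
proof (rule wp_mono)
  show "wp V skip 0 2 Q (s, m)"
    unfolding skip_def using assms(2) wp_Assign[of V "Num 0" s Q 9 m] by (simp add: numeral_2_eq_2)
qed (use assms in simp_all)

text \<open>The scalar registers 0 to 3 hold \<open>|F|\<close>, \<open>|U|\<close>, \<open>k\<close> and \<open>|F|^k\<close>, registers 4 to 6 are loop
  counters, and registers 7 and 8 hold \<open>|F|^i\<close> and \<open>2^j\<close>. Array 1 is the listing. Array 2 maps the
  rank of a member of the family to its code, the number with the bits of its bitstring, and array
  \<open>h\<close> maps a code to the successor of the rank, and to 0 if it is not the code of a member.\<close>

definition transform_step :: "nat \<Rightarrow> nat \<Rightarrow> ring_op \<Rightarrow> rcom" where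
  "transform_step h a g =
     RSeq (Plain (Assign 9 (Sub (Div (Var 6) (Var 7)) (Mul (Div (Div (Var 6) (Var 7)) (Var 0)) (Var 0)))))
    (RSeq (Plain (Assign 10 (Get 2 (Var 9))))
    (RIf (Sub (Div (Var 10) (Var 8)) (Mul (Div (Div (Var 10) (Var 8)) (Num 2)) (Num 2)))
      (RSeq (Plain (Assign 11 (Get h (Sub (Var 10) (Var 8)))))
      (RIf (Var 11)
        (ROp g (a, Var 6) (a, Var 6)
          (a, Add (Sub (Var 6) (Mul (Var 9) (Var 7))) (Mul (Sub (Var 11) (Num 1)) (Var 7))))
        skip))
      skip))"

definition transform :: "nat \<Rightarrow> nat \<Rightarrow> ring_op \<Rightarrow> rcom" where
  "transform h a g =
     RSeq (Plain (Assign 7 (Num 1)))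
    (rfor 4 2
      (RSeq (Plain (Assign 8 (Num 1)))
      (RSeq (rfor 5 1
        (RSeq (rfor 6 3 (transform_step h a g))
          (Plain (Assign 8 (Mul (Var 8) (Num 2))))))
        (Plain (Assign 7 (Mul (Var 7) (Var 0)))))))"

definition multiply_tables :: rcom where
  "multiply_tables = rfor 6 3 (ROp RMul (2, Var 6) (0, Var 6) (1, Var 6))"

definition table_size :: rcom where
  "table_size = RSeq (Plain (Assign 3 (Num 1))) (rfor 4 2 (Plain (Assign 3 (Mul (Var 3) (Var 0)))))"

definition code_member :: "nat \<Rightarrow> rcom" where
  "code_member h =
     RSeq (Plain (Assign 8 (Num 1)))
    (RSeq (Plain (Assign 10 (Num 0)))
    (RSeq (rfor 5 1
      (RSeq (Plain (Assign 10
          (Add (Var 10) (Mul (Get 1 (Add (Mul (Var 4) (Var 1)) (Var 5))) (Var 8)))))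
        (Plain (Assign 8 (Mul (Var 8) (Num 2))))))
    (RSeq (Plain (Put 2 (Var 4) (Var 10)))
      (Plain (Put h (Var 10) (Add (Var 4) (Num 1)))))))"

text \<open>\<open>L\<close> is understood only when register 2 holds 0, and its output replaces
  \<open>|U|\<close> in register 0 by \<open>|F|\<close>. Hence \<open>|U|\<close> and
  \<open>k\<close> are parked in \<open>h\<close> and \<open>Suc h\<close>, register 2 is cleared
  for the run, and both are restored afterwards.\<close>

definition cover_program :: "com \<Rightarrow> nat \<Rightarrow> rcom" where
  "cover_program L h =
     RSeq (Plain (Assign h (Var 0)))
    (RSeq (Plain (Assign (Suc h) (Var 2)))
    (RSeq (Plain (Assign 2 (Num 0)))
    (RSeq (Plain L)
    (RSeq (Plain (Assign 1 (Var h)))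
    (RSeq (Plain (Assign 2 (Var (Suc h))))
    (RSeq table_size
    (RSeq (rfor 4 0 (code_member h))
    (RSeq (transform h 0 RAdd)
    (RSeq (transform h 1 RAdd)
    (RSeq multiply_tables
      (transform h 2 RSub)))))))))))"

locale cover_instance = listed_family I for I :: "'u set_system" +
  fixes k h :: nat
  assumes k_pos: "1 \<le> k" and h_ge: "3 \<le> h"
begin

text \<open>Table indices need \<open>k * n\<close> bits; the factor 2 accommodates addresses in the
  listing, since \<open>F * n\<close> is at most \<open>2 ^ n * 2 ^ n\<close>.\<close>

definition V :: nat where "V = 2 ^ (2 * (k * n) + 2)"

lemma two_power_le_V: "x \<le> 2 * (k * n) + 2 \<Longrightarrow> (2::nat) ^ x \<le> V"
  unfolding V_def by (rule power_increasing) simp_all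

lemma n_le_kn: "n \<le> k * n"
  using k_pos by simp

lemma F_power_le: "F ^ k \<le> 2 ^ (k * n)"
  using power_mono[OF F_le, of k] by (simp add: power_mult[symmetric] mult.commute)

lemma le_V:
  "2 \<le> V" "n \<le> V" "k \<le> V" "F \<le> V" "F ^ k \<le> V" "2 ^ n \<le> V" "F * n \<le> V"
proof -
  have small: "x \<le> V" if "x \<le> 2 * (k * n)" for x
    using that less_exp[of x] two_power_le_V[of x] by linarith
  show "2 \<le> V" using two_power_le_V[of 1] by simp
  show "n \<le> V" using n_le_kn by (intro small) linarith
  show "k \<le> V" using n_pos by (intro small) simp
  show pn: "2 ^ n \<le> V" using n_le_kn by (intro two_power_le_V) linarith
  then show "F \<le> V" using F_le by (rule le_trans[rotated])
  show "F ^ k \<le> V" using F_power_le two_power_le_V[of "k * n"] by simp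
  have "F * n \<le> 2 ^ n * 2 ^ n"
    using F_le less_exp[of n] by (intro mult_le_mono) simp_all
  also have "\<dots> = 2 ^ (n + n)" by (simp add: power_add)
  also have "\<dots> \<le> V" using n_le_kn by (intro two_power_le_V) linarith
  finally show "F * n \<le> V" .
qed

lemma power_le_table_size: "i \<le> k \<Longrightarrow> F ^ i \<le> F ^ k"
  using F_pos by (intro power_increasing) simp_all

text \<open>Array \<open>h\<close> is prescribed at the codes of all subsets of the ground set,
  because it has to decide whether a set with one element deleted is still a member.\<close>

definition base :: "store \<Rightarrow> bool" where
  "base s \<longleftrightarrow> scal s 0 = F \<and> scal s 1 = n \<and> scal s 2 = k \<and> scal s 3 = F ^ k \<and>
     (\<forall>S\<in>family I. arr s 2 (rank I S) = code S) \<and>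
     (\<forall>S. S \<subseteq> universe I \<longrightarrow> arr s h (code S) = (if S \<in> family I then Suc (rank I S) else 0))"

lemma base_scal_update [simp]:
  "v 0 = scal s 0 \<Longrightarrow> v 1 = scal s 1 \<Longrightarrow> v 2 = scal s 2 \<Longrightarrow> v 3 = scal s 3 \<Longrightarrow>
    base (s\<lparr>scal := v\<rparr>) = base s"
  by (simp add: base_def)

text \<open>The ideal effect of one pass, with all operands taken from the old table
  \<open>T\<close>; the program updates the table in place instead.\<close>

definition step_table ::
  "ring_op \<Rightarrow> nat \<Rightarrow> nat \<Rightarrow> ((nat \<Rightarrow> 'u set) \<Rightarrow> 'r::{comm_ring,comm_monoid_mult}) \<Rightarrow> (nat \<Rightarrow> 'u set) \<Rightarrow> 'r" where
  "step_table g i j T f =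
     (if ground I ! j \<in> f (Suc i) \<and> f (Suc i) - {ground I ! j} \<in> family I
      then ring_eval g (T f) (T (f(Suc i := f (Suc i) - {ground I ! j})))
      else T f)"

lemma wp_transform_step:
  assumes s: "base s" "scal s 6 = tuple_index I k f" "scal s 7 = F ^ i" "scal s 8 = 2 ^ j"
    and f: "f \<in> tuples (family I) k" and i: "i < k" and j: "j < n"
    and Q: "\<And>s'. base s' \<Longrightarrow> (\<And>x. x < 9 \<Longrightarrow> scal s' x = scal s x) \<Longrightarrow>
      Q (s', m(a := (m a)(tuple_index I k f :=
        step_table g i j (\<lambda>f. m a (tuple_index I k f)) f)))"
  shows "wp V (transform_step h a g) 1 60 Q (s, m)"
proof -
  define S where "S = f (Suc i)"
  define u where "u = ground I ! j"
  have S: "S \<in> family I"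
    unfolding S_def using i by (intro tuples_mem[OF f]) simp
  then have SU: "S \<subseteq> universe I" using subset by blast
  have idx: "tuple_index I k f < F ^ k" by (rule tuple_index_less[OF f])
  have idx_V: "tuple_index I k f \<le> V" using idx le_V(5) by linarith
  have p_V: "F ^ i \<le> V" using power_le_table_size[of i] i le_V(5) by linarith
  have w_V: "(2::nat) ^ j \<le> V"
    using power_increasing[of j n "2::nat"] j le_V(6) by linarith
  have rank_V: "rank I T \<le> V" "Suc (rank I T) \<le> V" if "T \<in> family I" for T
    using rank_less[OF that] le_V(4) by simp_all
  have code_V: "code T \<le> V" for T
    using code_less[of T] le_V(6) by linarith
  \<comment> \<open>The machine has no remainder operation, so x mod b is computed as x - (x div b)
    * b.\<close>
  have digit: "tuple_index I k f div F ^ i - tuple_index I k f div F ^ i div F * F = rank I S"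
    using tuple_index_digit[OF f i] by (simp add: S_def minus_div_mult_eq_mod)
  have bit: "code S div 2 ^ j - code S div 2 ^ j div 2 * 2 = of_bool (u \<in> S)"
    using code_digit[OF j, of S] by (simp add: u_def minus_div_mult_eq_mod)
  have div_V: "x div y \<le> V" if "x \<le> V" for x y
    using that div_le_dividend[of x y] by linarith
  have div_mult_V: "x div y * y \<le> V" if "x \<le> V" for x y
    using that div_times_less_eq_dividend[of x y] by linarith
  let ?s1 = "set_scal 9 (rank I S) s"
  let ?s2 = "set_scal 10 (code S) ?s1"
  let ?s3 = "set_scal 11 (arr s h (code (S - {u}))) ?s2"
  let ?op = "ROp g (a, Var 6) (a, Var 6)
    (a, Add (Sub (Var 6) (Mul (Var 9) (Var 7))) (Mul (Sub (Var 11) (Num 1)) (Var 7)))"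
  have skip: "wp V skip 1 t Q (s', m)"
    if "2 \<le> t" "\<not> (u \<in> S \<and> S - {u} \<in> family I)" "base s'" "\<And>x. x < 9 \<Longrightarrow> scal s' x = scal s x"
    for s' t
  proof (rule wp_skip)
    have "step_table g i j (\<lambda>f. m a (tuple_index I k f)) f = m a (tuple_index I k f)"
      using that(2) by (auto simp: step_table_def S_def u_def)
    then show "Q (set_scal 9 0 s', m)"
      using Q[of "set_scal 9 0 s'"] that(3,4) by simp
  qed (rule that)
  have op: "wp V ?op 1 20 Q (?s3, m)" if "u \<in> S" "S - {u} \<in> family I"
  proof -
    let ?f' = "f(Suc i := S - {u})"
    have f': "?f' \<in> tuples (family I) k"
      using i that(2) by (intro tuples_upd[OF f]) simp_all
    have upd: "tuple_index I k ?f' + rank I S * F ^ i =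
        tuple_index I k f + rank I (S - {u}) * F ^ i"
      unfolding S_def by (rule tuple_index_upd[OF i])
    \<comment> \<open>The contribution of one digit is at most the whole index, so the truncated
      subtraction in the address is exact.\<close>
    have dig: "rank I S * F ^ i \<le> tuple_index I k f"
    proof -
      have "rank I S * F ^ i \<le> tuple_index I k f div F ^ i * F ^ i"
        by (rule mult_right_mono) (simp_all flip: digit)
      then show ?thesis using div_times_less_eq_dividend le_trans by blast
    qed
    have addr: "tuple_index I k f - rank I S * F ^ i + rank I (S - {u}) * F ^ i =
        tuple_index I k ?f'"
      using upd dig by linarith
    have addr_V: "tuple_index I k ?f' \<le> V"
      using tuple_index_less[OF f'] le_V(5) by linarith
    have "S - {u} \<subseteq> universe I" using SU by blast
    then have member: "arr s h (code (S - {u})) = Suc (rank I (S - {u}))"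
      using s(1) that by (simp add: base_def)
    have "step_table g i j (\<lambda>f. m a (tuple_index I k f)) f =
        ring_eval g (m a (tuple_index I k f)) (m a (tuple_index I k ?f'))"
      using that by (simp add: step_table_def S_def u_def)
    then have "Q (?s3, m(a := (m a)(tuple_index I k f :=
        ring_eval g (m a (tuple_index I k f)) (m a (tuple_index I k ?f')))))"
      using Q[of ?s3] s(1) by simp
    moreover have "rank I S * F ^ i \<le> V" using dig idx_V by linarith
    moreover have "rank I (S - {u}) * F ^ i \<le> V" using addr addr_V by linarith
    ultimately have "wp V ?op 1 (Suc (exp_ops (Var 6) + exp_ops (Var 6) +
        exp_ops (Add (Sub (Var 6) (Mul (Var 9) (Var 7))) (Mul (Sub (Var 11) (Num 1)) (Var 7)))))
        Q (?s3, m)"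
      using s member addr addr_V idx_V p_V le_V(1) rank_V[OF S] rank_V[OF that(2)]
      by (intro wp_ROp) simp_all
    then show ?thesis by (rule wp_mono) simp_all
  qed
  let ?inner = "RSeq (Plain (Assign 11 (Get h (Sub (Var 10) (Var 8))))) (RIf (Var 11) ?op skip)"
  have inner: "wp V ?inner 1 30 Q (?s2, m)" if "u \<in> S"
  proof -
    have sub: "S - {u} \<subseteq> universe I" using SU by blast
    have addr: "code S - 2 ^ j = code (S - {u})"
      using code_remove[OF j, of S] that by (simp add: u_def)
    have "arr s h (code (S - {u})) \<le> V"
      using s(1) sub rank_V[of "S - {u}"] by (auto simp: base_def)
    then have "wp V ?inner (0 + 1) (Suc (exp_ops (Get h (Sub (Var 10) (Var 8)))) +
        Suc (exp_ops (Var 11) + 20)) Q (?s2, m)"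
    proof (intro wp_Seq wp_Assign_value[where v = "arr s h (code (S - {u}))"] wp_If)
      assume "eval (Var 11) ?s3 \<noteq> 0"
      then have "S - {u} \<in> family I"
        using s(1) sub by (auto simp: base_def split: if_splits)
      then show "wp V ?op 1 20 Q (?s3, m)" by (rule op[OF that])
    next
      assume "eval (Var 11) ?s3 = 0"
      then have "S - {u} \<notin> family I"
        using s(1) sub by (auto simp: base_def)
      then show "wp V skip 1 20 Q (?s3, m)"
        using s(1) by (intro skip) simp_all
    qed (use s addr code_V w_V in simp_all)
    then show ?thesis by (rule wp_mono) simp_all
  qed
  have "wp V (transform_step h a g) (0 + (0 + 1))
      (Suc (exp_ops (Sub (Div (Var 6) (Var 7)) (Mul (Div (Div (Var 6) (Var 7)) (Var 0)) (Var 0)))) +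
       (Suc (exp_ops (Get 2 (Var 9))) +
       (Suc (exp_ops (Sub (Div (Var 10) (Var 8)) (Mul (Div (Div (Var 10) (Var 8)) (Num 2)) (Num 2)))
         + 30)))) Q (s, m)"
    unfolding transform_step_def
  proof (rule wp_Seq, rule wp_Assign_value[where v = "rank I S"],
      rule_tac[3] wp_Seq, rule_tac[3] wp_Assign_value[where v = "code S"], rule_tac[5] wp_If)
    show "fits V (Sub (Div (Var 6) (Var 7)) (Mul (Div (Div (Var 6) (Var 7)) (Var 0)) (Var 0))) s"
      using s idx_V p_V by (simp add: base_def le_V div_mult_V div_V)
    show "eval (Sub (Div (Var 6) (Var 7)) (Mul (Div (Div (Var 6) (Var 7)) (Var 0)) (Var 0))) s =
        rank I S"
      using s digit by (simp add: base_def)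
    show "fits V (Get 2 (Var 9)) ?s1" "eval (Get 2 (Var 9)) ?s1 = code S"
      using s S rank_V[OF S] code_V by (simp_all add: base_def)
    show "fits V (Sub (Div (Var 10) (Var 8)) (Mul (Div (Div (Var 10) (Var 8)) (Num 2)) (Num 2))) ?s2"
      using s code_V w_V le_V(1) by (simp add: div_mult_V div_V)
  next
    assume "eval (Sub (Div (Var 10) (Var 8)) (Mul (Div (Div (Var 10) (Var 8)) (Num 2)) (Num 2))) ?s2 \<noteq> 0"
    then have "u \<in> S" using s bit by (auto split: if_splits)
    then show "wp V ?inner 1 30 Q (?s2, m)" by (rule inner)
  next
    assume "eval (Sub (Div (Var 10) (Var 8)) (Mul (Div (Div (Var 10) (Var 8)) (Num 2)) (Num 2))) ?s2 = 0"
    then have "u \<notin> S" using s bit by auto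
    then show "wp V skip 1 30 Q (?s2, m)"
      using s(1) by (intro skip) simp_all
  qed
  then show ?thesis by (rule wp_mono) simp_all
qed

abbreviation holds :: "(nat \<Rightarrow> 'r) \<Rightarrow> ((nat \<Rightarrow> 'u set) \<Rightarrow> 'r) \<Rightarrow> bool" where
  "holds \<equiv> holds_table I k"

text \<open>In-place updating agrees with \<open>step_table\<close>: an entry read from another
  tuple has the same value before and after its own visit.\<close>

lemma wp_transform_coordinate:
  assumes s: "base s" "scal s 7 = F ^ i" "scal s 8 = 2 ^ j"
    and m: "holds (m a) T" and i: "i < k" and j: "j < n"
    and Q: "\<And>s' m'. base s' \<Longrightarrow> (\<And>x. x \<in> {4, 5, 7, 8} \<Longrightarrow> scal s' x = scal s x) \<Longrightarrow>
      (\<And>b. b \<noteq> a \<Longrightarrow> m' b = m b) \<Longrightarrow> holds (m' a) (step_table g i j T) \<Longrightarrow> Q (s', m')"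
  shows "wp V (rfor 6 3 (transform_step h a g)) (F ^ k) (F ^ k * 68 + 6) Q (s, m)"
proof -
  define Inv where "Inv = (\<lambda>x s' m'. base s' \<and>
    (\<forall>x\<in>{4, 5, 7, 8}. scal s' x = scal s x) \<and> (\<forall>b. b \<noteq> a \<longrightarrow> m' b = m b) \<and>
    (\<forall>f\<in>tuples (family I) k. m' a (tuple_index I k f) =
      (if tuple_index I k f < x then step_table g i j T f else T f)))"
  have "wp V (rfor 6 3 (transform_step h a g)) (F ^ k * 1) (F ^ k * (60 + 8) + 6) Q (s, m)"
  proof (rule wp_for[where Inv = Inv])
    show "scal s 3 = F ^ k" using s by (simp add: base_def)
    show "Inv 0 (set_scal 6 0 s) m"
      using s m by (simp add: Inv_def holds_table_def)
  next
    fix x s' m'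
    assume x: "x < F ^ k" "scal s' 6 = x" "scal s' 3 = F ^ k" and inv: "Inv x s' m'"
    obtain f where f: "f \<in> tuples (family I) k" "x = tuple_index I k f"
      using x(1) tuple_index_image[of k] by (metis (no_types, lifting) imageE lessThan_iff)
    have old: "m' a (tuple_index I k f') = step_table g i j T f'"
      if "f' \<in> tuples (family I) k" "tuple_index I k f' < x" for f'
      using inv that by (simp add: Inv_def)
    have new: "m' a (tuple_index I k f') = T f'"
      if "f' \<in> tuples (family I) k" "\<not> tuple_index I k f' < x" for f'
      using inv that by (simp add: Inv_def)
    have step: "step_table g i j (\<lambda>f. m' a (tuple_index I k f)) f = step_table g i j T f"
    proof (cases "ground I ! j \<in> f (Suc i) \<and> f (Suc i) - {ground I ! j} \<in> family I")
      case True
      let ?f' = "f(Suc i := f (Suc i) - {ground I ! j})"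
      have "?f' \<in> tuples (family I) k"
        using i True by (intro tuples_upd[OF f(1)]) simp_all
      \<comment> \<open>The deleted element is absent from this component of \<open>?f'\<close>, so
        the entry is untouched by the pass, visited or not.\<close>
      moreover have "step_table g i j T ?f' = T ?f'"
        by (simp add: step_table_def)
      ultimately have "m' a (tuple_index I k ?f') = T ?f'"
        using old[of ?f'] new[of ?f'] by metis
      then show ?thesis
        using True new[OF f(1)] f(2) by (simp add: step_table_def)
    next
      case False
      then show ?thesis
        using new[OF f(1)] f(2) by (auto simp: step_table_def)
    qed
    show "wp V (transform_step h a g) 1 60
        (\<lambda>(s, m). scal s 6 = x \<and> scal s 3 = F ^ k \<and> Inv (Suc x) (set_scal 6 (Suc x) s) m) (s', m')"
    proof (rule wp_transform_step[OF _ _ _ _ f(1) i j])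
      show "base s'" "scal s' 6 = tuple_index I k f" "scal s' 7 = F ^ i" "scal s' 8 = 2 ^ j"
        using inv s x f(2) by (simp_all add: Inv_def)
      fix s'' assume s'': "base s''" "\<And>x. x < 9 \<Longrightarrow> scal s'' x = scal s' x"
      let ?m = "m'(a := (m' a)(tuple_index I k f :=
        step_table g i j (\<lambda>f. m' a (tuple_index I k f)) f))"
      have "?m a (tuple_index I k f') =
          (if tuple_index I k f' < Suc x then step_table g i j T f' else T f')"
        if f': "f' \<in> tuples (family I) k" for f'
      proof (cases "f' = f")
        case True
        then show ?thesis using step f(2) by simp
      next
        case False
        then have "tuple_index I k f' \<noteq> x"
          using inj_onD[OF tuple_index_inj, of k f' f] f f' by auto
        then show ?thesis
          using old[OF f'] new[OF f'] f(2) by (simp add: less_Suc_eq)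
      qed
      then have "Inv (Suc x) (set_scal 6 (Suc x) s'') ?m"
        using inv s'' by (simp add: Inv_def)
      then show "case (s'', ?m) of (s, m) \<Rightarrow>
          scal s 6 = x \<and> scal s 3 = F ^ k \<and> Inv (Suc x) (set_scal 6 (Suc x) s) m"
        using s'' x by simp
    qed
  next
    fix s' m' assume "Inv (F ^ k) s' m'"
    then show "Q (s', m')"
      using tuple_index_less by (intro Q) (auto simp: Inv_def holds_table_def)
  qed (use le_V in simp_all)
  then show ?thesis by simp
qed

text \<open>The intermediate tables \<open>T i j\<close> are left abstract so that one loop proof
  serves both the zeta transform and its inverse, which differ only in \<open>g\<close> and in the
  set of coordinates that \<open>T\<close> accounts for.\<close>

lemma wp_transform:
  assumes s: "base s" and m: "holds (m a) (T 0 0)"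
    and step: "\<And>i j f. i < k \<Longrightarrow> j < n \<Longrightarrow> f \<in> tuples (family I) k \<Longrightarrow>
      T i (Suc j) f = step_table g i j (T i j) f"
    and wrap: "\<And>i f. i < k \<Longrightarrow> f \<in> tuples (family I) k \<Longrightarrow> T (Suc i) 0 f = T i n f"
    and Q: "\<And>s' m'. base s' \<Longrightarrow> (\<And>b. b \<noteq> a \<Longrightarrow> m' b = m b) \<Longrightarrow> holds (m' a) (T k 0) \<Longrightarrow>
      Q (s', m')"
  shows "wp V (transform h a g) (k * (n * F ^ k)) (114 * (k * (n * F ^ k)) + 8) Q (s, m)"
proof -
  let ?N = "F ^ k"
  have N_pos: "1 \<le> ?N" using F_pos by (simp add: Suc_leI)
  let ?coord = "RSeq (rfor 6 3 (transform_step h a g)) (Plain (Assign 8 (Mul (Var 8) (Num 2))))"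
  let ?comp = "RSeq (Plain (Assign 8 (Num 1)))
    (RSeq (rfor 5 1 ?coord) (Plain (Assign 7 (Mul (Var 7) (Var 0)))))"
  define InvJ where "InvJ = (\<lambda>i j s' m'. base s' \<and> scal s' 4 = i \<and> scal s' 7 = F ^ i \<and>
    scal s' 8 = 2 ^ j \<and> (\<forall>b. b \<noteq> a \<longrightarrow> m' b = m b) \<and> holds (m' a) (T i j))"
  define InvI where "InvI = (\<lambda>i s' m'. base s' \<and> scal s' 7 = F ^ i \<and>
    (\<forall>b. b \<noteq> a \<longrightarrow> m' b = m b) \<and> holds (m' a) (T i 0))"
  have coord: "wp V ?coord (?N + 0) (?N * 68 + 6 + Suc (exp_ops (Mul (Var 8) (Num 2))))
      (\<lambda>(s, m). scal s 5 = j \<and> scal s 1 = n \<and> InvJ i (Suc j) (set_scal 5 (Suc j) s) m) (s', m')"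
    if i: "i < k" and j: "j < n" "scal s' 5 = j" and inv: "InvJ i j s' m'" for i j s' m'
  proof (intro wp_Seq, rule wp_transform_coordinate[where i = i and j = j and T = "T i j"])
    fix s'' m''
    assume s'': "base s''" "\<And>x. x \<in> {4, 5, 7, 8} \<Longrightarrow> scal s'' x = scal s' x"
      and m'': "\<And>b. b \<noteq> a \<Longrightarrow> m'' b = m' b" "holds (m'' a) (step_table g i j (T i j))"
    have w: "(2::nat) ^ j * 2 \<le> V"
      using power_increasing[of "Suc j" n "2::nat"] j(1) le_V(6) by simp
    have w': "(2::nat) ^ j \<le> V" using w by simp
    have "holds (m'' a) (T i (Suc j))"
      using m''(2) step[OF i j(1)] by (simp add: holds_table_def)
    then have "InvJ i (Suc j) (set_scal 5 (Suc j) (set_scal 8 (2 ^ j * 2) s'')) m''"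
      using inv s'' m'' by (simp add: InvJ_def)
    then show "wp V (Plain (Assign 8 (Mul (Var 8) (Num 2)))) 0
        (Suc (exp_ops (Mul (Var 8) (Num 2))))
        (\<lambda>(s, m). scal s 5 = j \<and> scal s 1 = n \<and> InvJ i (Suc j) (set_scal 5 (Suc j) s) m)
        (s'', m'')"
      using s'' j(2) inv w w' le_V(1)
      by (intro wp_Assign_value[where v = "2 ^ j * 2"]) (simp_all add: InvJ_def base_def[of s''])
  qed (use i j inv in \<open>simp_all add: InvJ_def\<close>)
  have comp: "wp V ?comp (0 + (n * (?N + 0) + 0))
      (Suc (exp_ops (Num 1)) + ((n * (?N * 68 + 6 + Suc (exp_ops (Mul (Var 8) (Num 2))) + 8) + 6) +
        Suc (exp_ops (Mul (Var 7) (Var 0)))))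
      (\<lambda>(s, m). scal s 4 = i \<and> scal s 2 = k \<and> InvI (Suc i) (set_scal 4 (Suc i) s) m) (s', m')"
    if i: "i < k" "scal s' 4 = i" and inv: "InvI i s' m'" for i s' m'
  proof (intro wp_Seq wp_Assign_value[where v = 1], rule_tac[3] wp_for[where Inv = "InvJ i"])
    show "scal (set_scal 8 1 s') 1 = n"
      using inv by (simp add: InvI_def base_def)
    show "InvJ i 0 (set_scal 5 0 (set_scal 8 1 s')) m'"
      using inv i by (simp add: InvI_def InvJ_def)
  next
    fix j s'' m''
    assume "j < n" "scal s'' 5 = j" "scal s'' 1 = n" "InvJ i j s'' m''"
    then show "wp V ?coord (?N + 0) (?N * 68 + 6 + Suc (exp_ops (Mul (Var 8) (Num 2))))
        (\<lambda>(s, m). scal s 5 = j \<and> scal s 1 = n \<and> InvJ i (Suc j) (set_scal 5 (Suc j) s) m)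
        (s'', m'')"
      using i by (intro coord)
  next
    fix s'' m'' assume s'': "InvJ i n s'' m''"
    have p: "F ^ i * F \<le> V"
      using power_le_table_size[of "Suc i"] i(1) le_V(5) by (simp add: mult.commute)
    have p': "F ^ i \<le> V"
      using power_le_table_size[of i] i(1) le_V(5) by simp
    have "InvI (Suc i) (set_scal 4 (Suc i) (set_scal 7 (F ^ i * F) s'')) m''"
      using s'' wrap[OF i(1)] by (simp add: InvI_def InvJ_def holds_table_def mult.commute)
    then show "wp V (Plain (Assign 7 (Mul (Var 7) (Var 0)))) 0
        (Suc (exp_ops (Mul (Var 7) (Var 0))))
        (\<lambda>(s, m). scal s 4 = i \<and> scal s 2 = k \<and> InvI (Suc i) (set_scal 4 (Suc i) s) m)
        (s'', m'')"
      using s'' p p' le_V(4)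
      by (intro wp_Assign_value[where v = "F ^ i * F"]) (simp_all add: InvJ_def base_def[of s''])
  qed (use le_V in simp_all)
  let ?t = "Suc (exp_ops (Num 1)) + ((n * (?N * 68 + 6 + Suc (exp_ops (Mul (Var 8) (Num 2))) + 8) +
    6) + Suc (exp_ops (Mul (Var 7) (Var 0))))"
  have "wp V (transform h a g) (0 + k * (0 + (n * (?N + 0) + 0)))
      (Suc (exp_ops (Num 1)) + (k * (?t + 8) + 6)) Q (s, m)"
    unfolding transform_def
  proof (intro wp_Seq wp_Assign_value[where v = 1], rule_tac[3] wp_for[where Inv = InvI])
    show "scal (set_scal 7 1 s) 2 = k"
      using s by (simp add: base_def)
    show "InvI 0 (set_scal 4 0 (set_scal 7 1 s)) m"
      using s m by (simp add: InvI_def)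
  next
    fix i s' m'
    assume "i < k" "scal s' 4 = i" "scal s' 2 = k" "InvI i s' m'"
    then show "wp V ?comp (0 + (n * (?N + 0) + 0)) ?t
        (\<lambda>(s, m). scal s 4 = i \<and> scal s 2 = k \<and> InvI (Suc i) (set_scal 4 (Suc i) s) m) (s', m')"
      by (intro comp)
  next
    fix s' m' assume "InvI k s' m'"
    then show "Q (s', m')" by (intro Q) (simp_all add: InvI_def)
  qed (use le_V in simp_all)
  then show ?thesis
  proof (rule wp_mono)
    let ?X = "k * (n * ?N)"
    \<comment> \<open>Both \<open>k * n\<close> and \<open>k\<close> are at most \<open>?X\<close>,
      so the coefficients add up to 106, below 114.\<close>
    have "Suc (exp_ops (Num 1)) + (k * (?t + 8) + 6) = 68 * ?X + 18 * (k * n) + 20 * k + 8"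
      by (simp add: algebra_simps)
    moreover have "k * n \<le> ?X"
      using mult_le_mono2[OF mult_le_mono2[OF N_pos], of k n] by simp
    moreover have "k * 1 \<le> k * n"
      using n_pos by (intro mult_le_mono2) simp
    ultimately show "Suc (exp_ops (Num 1)) + (k * (?t + 8) + 6) \<le> 114 * ?X + 8"
      by linarith
  qed simp_all
qed

lemma wp_multiply_tables:
  assumes s: "base s"
    and Q: "\<And>s' m'. base s' \<Longrightarrow>
      (\<And>x. x < F ^ k \<Longrightarrow> m' 2 x = m 0 x * m 1 x) \<Longrightarrow> Q (s', m')"
  shows "wp V multiply_tables (F ^ k) (F ^ k * 12 + 6) Q (s, m)"
proof -
  define Inv where "Inv = (\<lambda>x s' m'. base s' \<and> m' 0 = m 0 \<and> m' 1 = m 1 \<and>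
    (\<forall>y<x. m' (2::nat) y = m 0 y * m 1 y))"
  have "wp V multiply_tables (F ^ k * 1)
      (F ^ k * (Suc (exp_ops (Var 6) + exp_ops (Var 6) + exp_ops (Var 6)) + 8) + 6) Q (s, m)"
    unfolding multiply_tables_def
  proof (rule wp_for[where Inv = Inv])
    fix x s' m'
    assume "x < F ^ k" "scal s' 6 = x" "scal s' 3 = F ^ k" "Inv x s' m'"
    then show "wp V (ROp RMul (2, Var 6) (0, Var 6) (1, Var 6)) 1
        (Suc (exp_ops (Var 6) + exp_ops (Var 6) + exp_ops (Var 6)))
        (\<lambda>(s, m). scal s 6 = x \<and> scal s 3 = F ^ k \<and> Inv (Suc x) (set_scal 6 (Suc x) s) m) (s', m')"
      using le_V(5) by (intro wp_ROp) (simp_all add: Inv_def less_Suc_eq)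
  qed (use s le_V in \<open>auto simp: Inv_def base_def[of s] intro: Q\<close>)
  then show ?thesis by (rule wp_mono) simp_all
qed

lemma wp_table_size:
  assumes s: "scal s 0 = F" "scal s 2 = k"
    and Q: "\<And>s'. scal s' 0 = F \<Longrightarrow> scal s' 1 = scal s 1 \<Longrightarrow> scal s' 2 = k \<Longrightarrow> scal s' 3 = F ^ k \<Longrightarrow>
      arr s' = arr s \<Longrightarrow> Q (s', m)"
  shows "wp V table_size 0 (k * 12 + 8) Q (s, m)"
proof -
  define Inv where "Inv = (\<lambda>i (s' :: store) m'. scal s' 0 = F \<and> scal s' 1 = scal s 1 \<and> scal s' 2 = k \<and>
    scal s' 3 = F ^ i \<and> arr s' = arr s \<and> m' = m)"
  have "wp V table_size (0 + k * 0)
      (Suc (exp_ops (Num 1)) + (k * (Suc (exp_ops (Mul (Var 3) (Var 0))) + 8) + 6)) Q (s, m)"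
    unfolding table_size_def
  proof (intro wp_Seq wp_Assign_value[where v = 1], rule_tac[3] wp_for[where Inv = Inv])
    fix i s' m'
    assume i: "i < k" "scal s' 4 = i" "scal s' 2 = k" "Inv i s' m'"
    have "F ^ i * F \<le> V" "F ^ i \<le> V"
      using power_le_table_size[of "Suc i"] power_le_table_size[of i] i(1) le_V(5)
      by (simp_all add: mult.commute)
    then show "wp V (Plain (Assign 3 (Mul (Var 3) (Var 0)))) 0 (Suc (exp_ops (Mul (Var 3) (Var 0))))
        (\<lambda>(s, m). scal s 4 = i \<and> scal s 2 = k \<and> Inv (Suc i) (set_scal 4 (Suc i) s) m) (s', m')"
      using i le_V(4) by (intro wp_Assign_value[where v = "F ^ i * F"]) (simp_all add: Inv_def)
  qed (use s le_V in \<open>auto simp: Inv_def intro: Q\<close>)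
  then show ?thesis by (rule wp_mono) (simp_all add: algebra_simps)
qed

section \<open>Building the arrays that translate between ranks and codes\<close>

definition params :: "store \<Rightarrow> bool" where
  "params s \<longleftrightarrow> scal s 0 = F \<and> scal s 1 = n \<and> scal s 2 = k \<and> scal s 3 = F ^ k"

lemma params_scal_update [simp]:
  "v 0 = scal s 0 \<Longrightarrow> v 1 = scal s 1 \<Longrightarrow> v 2 = scal s 2 \<Longrightarrow> v 3 = scal s 3 \<Longrightarrow>
    params (s\<lparr>scal := v\<rparr>) = params s"
  by (simp add: params_def)

definition lists_family :: "(nat \<Rightarrow> nat) \<Rightarrow> bool" where
  "lists_family b \<longleftrightarrow>
     (\<forall>S\<in>family I. \<forall>j<n. b (rank I S * n + j) = of_bool (ground I ! j \<in> S))"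

text \<open>Loop invariant of the construction: at \<open>r = 0\<close> it holds for a zero array
  \<open>h\<close>, and at \<open>r = F\<close> it is the array part of \<open>base\<close>.\<close>

definition coded :: "nat \<Rightarrow> store \<Rightarrow> bool" where
  "coded r s \<longleftrightarrow> (\<forall>S\<in>family I. rank I S < r \<longrightarrow> arr s 2 (rank I S) = code S) \<and>
     (\<forall>S. S \<subseteq> universe I \<longrightarrow>
        arr s h (code S) = (if S \<in> family I \<and> rank I S < r then Suc (rank I S) else 0))"

lemma base_if_coded: "params s \<Longrightarrow> coded F s \<Longrightarrow> base s"
  using rank_less by (auto simp: params_def coded_def base_def)

text \<open>Ranks are injective on the family and codes on all subsets of the ground set, so neither
  write disturbs an entry that belongs to another set.\<close>

lemma coded_Suc:
  assumes "coded (rank I S) s" and S: "S \<in> family I"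
    and s': "arr s' 2 = (arr s 2)(rank I S := code S)"
      "arr s' h = (arr s h)(code S := Suc (rank I S))"
  shows "coded (Suc (rank I S)) s'"
  unfolding coded_def
proof (intro conjI ballI allI impI)
  fix T assume T: "T \<in> family I" "rank I T < Suc (rank I S)"
  show "arr s' 2 (rank I T) = code T"
  proof (cases "T = S")
    case False
    then have "rank I T \<noteq> rank I S" using inj_onD[OF rank_inj _ T(1) S] by blast
    then show ?thesis using assms(1) T s' by (simp add: coded_def)
  qed (simp add: s')
next
  fix T assume T: "T \<subseteq> universe I"
  show "arr s' h (code T) =
      (if T \<in> family I \<and> rank I T < Suc (rank I S) then Suc (rank I T) else 0)"
  proof (cases "T = S")
    case True
    then show ?thesis using S by (simp add: s')
  next
    case False
    then have "code T \<noteq> code S" using code_inj[OF T, of S] S subset by blast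
    moreover have "rank I T < Suc (rank I S) \<longleftrightarrow> rank I T < rank I S" if "T \<in> family I"
      using inj_onD[OF rank_inj _ that S] False by (auto simp: less_Suc_eq)
    ultimately show ?thesis using assms(1) T s' by (auto simp: coded_def)
  qed
qed

lemma wp_code_member:
  assumes s: "params s" "lists_family (arr s 1)" "coded (rank I S) s" "scal s 4 = rank I S"
    and S: "S \<in> family I"
    and Q: "\<And>s'. params s' \<Longrightarrow> arr s' 1 = arr s 1 \<Longrightarrow> scal s' 4 = scal s 4 \<Longrightarrow>
      coded (Suc (rank I S)) s' \<Longrightarrow> Q (s', m)"
  shows "wp V (code_member h) 0 (n * 23 + 18) Q (s, m)"
proof -
  define acc where "acc = (\<lambda>j. \<Sum>i<j. of_bool (ground I ! i \<in> S) * (2::nat) ^ i)"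
  have acc_n: "acc n = code S" by (simp add: acc_def code_def)
  have acc_V: "acc j \<le> V" and w_V: "(2::nat) ^ j \<le> V" if "j \<le> n" for j
  proof -
    have "(2::nat) ^ j \<le> 2 ^ n" using that by simp
    then show "(2::nat) ^ j \<le> V" using le_V(6) by linarith
    moreover have "acc j < 2 ^ j"
      unfolding acc_def
      by (rule digit_sum_less[where d = "\<lambda>i. of_bool (ground I ! i \<in> S)"]) simp
    ultimately show "acc j \<le> V" by linarith
  qed
  define Inv where "Inv = (\<lambda>j s' m'. params s' \<and> arr s' = arr s \<and> scal s' 4 = scal s 4 \<and>
    scal s' 8 = 2 ^ j \<and> scal s' 10 = acc j \<and> m' = m)"
  let ?sum = "Add (Var 10) (Mul (Get 1 (Add (Mul (Var 4) (Var 1)) (Var 5))) (Var 8))"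
  let ?body = "RSeq (Plain (Assign 10 ?sum)) (Plain (Assign 8 (Mul (Var 8) (Num 2))))"
  have body: "wp V ?body (0 + 0) (Suc (exp_ops ?sum) + Suc (exp_ops (Mul (Var 8) (Num 2))))
      (\<lambda>(s, m). scal s 5 = j \<and> scal s 1 = n \<and> Inv (Suc j) (set_scal 5 (Suc j) s) m) (s', m')"
    if j: "j < n" "scal s' 5 = j" and inv: "Inv j s' m'" for j s' m'
  proof -
    have bit: "arr s 1 (rank I S * n + j) = of_bool (ground I ! j \<in> S)"
      using s(2) S j(1) by (simp add: lists_family_def)
    \<comment> \<open>Each member occupies \<open>n\<close> consecutive cells of the listing, all of
      them before cell \<open>F * n\<close>.\<close>
    have addr: "rank I S * n + j < Suc (rank I S) * n" using j(1) by simp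
    also have "\<dots> \<le> F * n" using rank_less[OF S] by (intro mult_right_mono) simp_all
    finally have "rank I S * n + j \<le> V" using le_V(7) by simp
    moreover have "acc j + of_bool (ground I ! j \<in> S) * 2 ^ j = acc (Suc j)"
      by (simp only: acc_def sum.lessThan_Suc)
    moreover have "rank I S \<le> V" using rank_less[OF S] le_V(4) by simp
    ultimately show ?thesis
      using j inv s(4) bit acc_V[of j] acc_V[of "Suc j"] w_V[of j] w_V[of "Suc j"] le_V(1,2)
      by (rule_tac wp_Seq, rule_tac wp_Assign_value[where v = "acc (Suc j)"],
          rule_tac[3] wp_Assign_value[where v = "2 ^ j * 2"]) (simp_all add: Inv_def params_def)
  qed
  have "wp V (code_member h)
      (0 + (0 + (n * (0 + 0) + (0 + 0))))
      (Suc (exp_ops (Num 1)) + (Suc (exp_ops (Num 0)) +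
        ((n * (Suc (exp_ops ?sum) + Suc (exp_ops (Mul (Var 8) (Num 2))) + 8) + 6) +
        (Suc (exp_ops (Var 4) + exp_ops (Var 10)) +
         Suc (exp_ops (Var 10) + exp_ops (Add (Var 4) (Num 1))))))) Q (s, m)"
    unfolding code_member_def
  proof (rule wp_Seq, rule wp_Assign_value[where v = 1], rule_tac[3] wp_Seq,
      rule_tac[3] wp_Assign_value[where v = 0], rule_tac[5] wp_Seq,
      rule_tac[5] wp_for[where Inv = Inv], rule_tac[10] wp_Seq)
    show "Inv 0 (set_scal 5 0 (set_scal 10 0 (set_scal 8 1 s))) m"
      using s by (simp add: Inv_def acc_def)
    show "scal (set_scal 10 0 (set_scal 8 1 s)) 1 = n"
      using s by (simp add: params_def)
  next
    fix j s' m'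
    assume "j < n" "scal s' 5 = j" "scal s' 1 = n" "Inv j s' m'"
    then show "wp V ?body (0 + 0) (Suc (exp_ops ?sum) + Suc (exp_ops (Mul (Var 8) (Num 2))))
        (\<lambda>(s, m). scal s 5 = j \<and> scal s 1 = n \<and> Inv (Suc j) (set_scal 5 (Suc j) s) m) (s', m')"
      by (intro body)
  next
    fix s' m' assume inv: "Inv n s' m'"
    let ?s1 = "s'\<lparr>arr := (arr s')(2 := (arr s' 2)(rank I S := code S))\<rparr>"
    let ?s2 = "?s1\<lparr>arr := (arr ?s1)(h := (arr ?s1 h)(code S := Suc (rank I S)))\<rparr>"
    have h: "h \<noteq> 2" "h \<noteq> 1" using h_ge by simp_all
    have "coded (Suc (rank I S)) ?s2"
      by (rule coded_Suc[OF s(3) S]) (use h inv in \<open>simp_all add: Inv_def\<close>)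
    moreover have "params ?s2" using inv by (simp add: Inv_def params_def)
    ultimately have "Q (?s2, m)"
      using inv h by (intro Q) (simp_all add: Inv_def)
    moreover have "rank I S \<le> V" "Suc (rank I S) \<le> V"
      using rank_less[OF S] le_V(4) by simp_all
    ultimately show "wp V (Plain (Put 2 (Var 4) (Var 10))) 0 (Suc (exp_ops (Var 4) + exp_ops (Var 10)))
        (wp V (Plain (Put h (Var 10) (Add (Var 4) (Num 1)))) 0
          (Suc (exp_ops (Var 10) + exp_ops (Add (Var 4) (Num 1)))) Q) (s', m')"
      using inv s(4) h acc_V[of n] acc_n le_V(1)
      by (intro wp_Put) (simp_all add: Inv_def)
  qed (use le_V in simp_all)
  then show ?thesis by (rule wp_mono) (simp_all add: algebra_simps)
qed

lemma wp_code_members: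
  assumes s: "params s" "lists_family (arr s 1)" "arr s h = (\<lambda>_. 0)"
    and Q: "\<And>s'. base s' \<Longrightarrow> Q (s', m)"
  shows "wp V (rfor 4 0 (code_member h)) 0 (F * (n * 23 + 26) + 6) Q (s, m)"
proof -
  define Inv where "Inv = (\<lambda>r s' m'. params s' \<and> arr s' 1 = arr s 1 \<and> coded r s' \<and> m' = m)"
  have coded_scal: "coded r (s\<lparr>scal := v\<rparr>) = coded r s" for r s v
    by (simp add: coded_def)
  have "wp V (rfor 4 0 (code_member h)) (F * 0) (F * (n * 23 + 18 + 8) + 6) Q (s, m)"
  proof (rule wp_for[where Inv = Inv])
    show "Inv 0 (set_scal 4 0 s) m"
      using s by (simp add: Inv_def coded_def)
  next
    fix r s' m'
    assume r: "r < F" "scal s' 4 = r" "scal s' 0 = F" "Inv r s' m'"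
    obtain S where S: "S \<in> family I" "r = rank I S"
      using r(1) rank_image by (metis (no_types, lifting) imageE lessThan_iff)
    show "wp V (code_member h) 0 (n * 23 + 18)
        (\<lambda>(s, m). scal s 4 = r \<and> scal s 0 = F \<and> Inv (Suc r) (set_scal 4 (Suc r) s) m) (s', m')"
    proof (rule wp_code_member[OF _ _ _ _ S(1)])
      fix s'' assume "params s''" "arr s'' 1 = arr s' 1" "scal s'' 4 = scal s' 4"
        "coded (Suc (rank I S)) s''"
      then show "case (s'', m') of (s, m) \<Rightarrow>
          scal s 4 = r \<and> scal s 0 = F \<and> Inv (Suc r) (set_scal 4 (Suc r) s) m"
        using r S by (simp add: Inv_def coded_scal params_def)
    qed (use r S s in \<open>simp_all add: Inv_def\<close>)
  next
    fix s' m' assume "Inv F s' m'"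
    then show "Q (s', m')"
      using base_if_coded by (auto simp: Inv_def intro: Q)
  qed (use s le_V in \<open>simp_all add: params_def\<close>)
  then show ?thesis by (simp add: algebra_simps)
qed

text \<open>Follows the loops of \<open>transform\<close>: the counters start at 0, so counter
  \<open>i\<close> works on component \<open>Suc i\<close>, of which the first \<open>j\<close>
  elements are done.\<close>

definition processed :: "nat \<Rightarrow> nat \<Rightarrow> (nat \<times> 'u) set" where
  "processed i j = {1..i} \<times> universe I \<union> {Suc i} \<times> set (take j (ground I))"

lemma processed_Suc:
  "j < n \<Longrightarrow> processed i (Suc j) = insert (Suc i, ground I ! j) (processed i j)"
  by (auto simp: processed_def n_def take_Suc_conv_app_nth)

lemma not_processed:
  assumes "j < n"
  shows "(Suc i, ground I ! j) \<notin> processed i j"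
proof -
  have "ground I ! j \<notin> set (take j (ground I))"
  proof
    assume "ground I ! j \<in> set (take j (ground I))"
    then obtain l where "l < j" "ground I ! l = ground I ! j"
      using assms by (auto simp: in_set_conv_nth)
    then show False
      using assms distinct by (simp add: n_def nth_eq_iff_index_eq)
  qed
  then show ?thesis by (simp add: processed_def)
qed

lemma processed_wrap: "processed (Suc i) 0 = processed i n"
  by (auto simp: processed_def n_def le_Suc_eq)

lemma processed_0: "processed 0 0 = {}"
  by (simp add: processed_def)

lemma processed_all: "processed k 0 = {1..k} \<times> universe I"
  by (simp add: processed_def)

lemma nth_in_universe: "j < n \<Longrightarrow> ground I ! j \<in> universe I"
  by (simp add: n_def)

lemma zeta_step:
  assumes "i < k" "j < n" "f \<in> tuples (family I) k"
  shows "zeta k (processed i (Suc j)) A f = step_table RAdd i j (zeta k (processed i j) A) f"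
  using zeta_insert[OF assms(3) _ not_processed[OF assms(2)], of i A] assms(1)
  by (simp add: processed_Suc[OF assms(2)] step_table_def)

text \<open>Undoing the zeta transform coordinate by coordinate, in any order, inverts it: at every
  moment the table is the zeta transform with respect to the coordinates that are left.\<close>

lemma moebius_step:
  assumes i: "i < k" and j: "j < n" and f: "f \<in> tuples (family I) k"
  shows "zeta k (processed k 0 - processed i (Suc j)) A f =
    step_table RSub i j (zeta k (processed k 0 - processed i j) A) f"
proof -
  let ?u = "ground I ! j"
  let ?Q = "processed k 0 - processed i (Suc j)"
  have Q: "processed k 0 - processed i j = insert (Suc i, ?u) ?Q"
    using i not_processed[OF j, of i] nth_in_universe[OF j]
    by (auto simp: processed_Suc[OF j] processed_all)
  have new: "(Suc i, ?u) \<notin> ?Q"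
    by (simp add: processed_Suc[OF j])
  have Si: "Suc i \<in> {1..k}" using i by simp
  show ?thesis
  proof (cases "?u \<in> f (Suc i) \<and> f (Suc i) - {?u} \<in> family I")
    case True
    let ?f' = "f(Suc i := f (Suc i) - {?u})"
    have "?f' \<in> tuples (family I) k"
      using True by (intro tuples_upd[OF f Si]) simp
    \<comment> \<open>\<open>?u\<close> is missing from this component of \<open>?f'\<close>, so
      permitting its deletion adds no terms; the table already holds exactly the summand to be
      subtracted.\<close>
    then have "zeta k (insert (Suc i, ?u) ?Q) A ?f' = zeta k ?Q A ?f'"
      using zeta_insert[OF _ Si new, of ?f' A] by simp
    then show ?thesis
      using zeta_insert[OF f Si new, of A] True by (simp add: Q step_table_def)
  next
    case False
    then show ?thesis
      using zeta_insert[OF f Si new, of A] by (auto simp: Q step_table_def)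
  qed
qed

lemma wp_zeta:
  assumes s: "base s" and m: "holds (m a) A"
    and Q: "\<And>s' m'. base s' \<Longrightarrow> (\<And>b. b \<noteq> a \<Longrightarrow> m' b = m b) \<Longrightarrow>
      holds (m' a) (zeta k ({1..k} \<times> universe I) A) \<Longrightarrow> Q (s', m')"
  shows "wp V (transform h a RAdd) (k * (n * F ^ k)) (114 * (k * (n * F ^ k)) + 8) Q (s, m)"
proof (rule wp_transform[where T = "\<lambda>i j. zeta k (processed i j) A", OF s])
  show "holds (m a) (zeta k (processed 0 0) A)"
    using m by (simp add: holds_table_def processed_0 zeta_empty)
  show "zeta k (processed i (Suc j)) A f = step_table RAdd i j (zeta k (processed i j) A) f"
    if "i < k" "j < n" "f \<in> tuples (family I) k" for i j f
    using that by (rule zeta_step)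
  show "zeta k (processed (Suc i) 0) A f = zeta k (processed i n) A f" for i f
    by (simp only: processed_wrap)
  show "Q (s', m')"
    if "base s'" "\<And>b. b \<noteq> a \<Longrightarrow> m' b = m b" "holds (m' a) (zeta k (processed k 0) A)" for s' m'
    using that unfolding processed_all by (rule Q)
qed

lemma wp_moebius:
  assumes s: "base s" and m: "holds (m a) (zeta k ({1..k} \<times> universe I) A)"
    and Q: "\<And>s' m'. holds (m' a) A \<Longrightarrow> Q (s', m')"
  shows "wp V (transform h a RSub) (k * (n * F ^ k)) (114 * (k * (n * F ^ k)) + 8) Q (s, m)"
proof (rule wp_transform[where T = "\<lambda>i j. zeta k (processed k 0 - processed i j) A", OF s])
  show "holds (m a) (zeta k (processed k 0 - processed 0 0) A)"
    using m by (simp add: processed_0 processed_all)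
  show "zeta k (processed k 0 - processed i (Suc j)) A f =
      step_table RSub i j (zeta k (processed k 0 - processed i j) A) f"
    if "i < k" "j < n" "f \<in> tuples (family I) k" for i j f
    using that by (rule moebius_step)
  show "zeta k (processed k 0 - processed (Suc i) 0) A f =
      zeta k (processed k 0 - processed i n) A f" for i f
    by (simp only: processed_wrap)
  show "Q (s', m')" if "holds (m' a) (zeta k (processed k 0 - processed k 0) A)" for s' m'
    using that by (intro Q) (simp add: holds_table_def zeta_empty)
qed

text \<open>The start stores for \<open>k\<close> and for 0 differ only in register 2, so clearing
  it leaves the store on which \<open>L\<close> is understood, up to two registers that
  \<open>L\<close> never names.\<close>

lemma exec_listing:
  assumes L: "exec L (start_store I 0) t s" and h: "com_bound L \<le> h"
  shows "exec L (set_scal 2 0 (set_scal (Suc h) k (set_scal h n (start_store I k)))) t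
    (set_scal (Suc h) k (set_scal h n s))"
proof -
  have "set_scal 2 0 (set_scal (Suc h) k (set_scal h n (start_store I k))) =
      set_scal (Suc h) k (set_scal h n (start_store I 0))"
    using h_ge by (simp add: start_store_def fun_eq_iff)
  moreover have "com_bound L \<le> Suc h" using h by simp
  ultimately show ?thesis
    using exec_scal_fresh[OF exec_scal_fresh[OF L h]] by metis
qed

text \<open>Three transforms and one pointwise product account for the factor 4 in the number of
  ring operations.\<close>

lemma wp_cover_program:
  fixes A B :: "(nat \<Rightarrow> 'u set) \<Rightarrow> 'r::{comm_ring,comm_monoid_mult}"
  assumes L: "exec L (start_store I 0) t s" "com_bound L \<le> h" "outputs_listing I s"
    and A: "holds (m 0) A" and B: "holds (m 1) B"
  shows "wp V (cover_program L h) (4 * (k * (n * F ^ k))) (500 * (k * (n * F ^ k)) + t)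
    (\<lambda>(s', m'). holds (m' 2) (comp_cover_product (family I) k A B)) (start_store I k, m)"
proof -
  let ?X = "k * (n * F ^ k)" and ?N = "F ^ k"
  let ?U = "{1..k} \<times> universe I"
  let ?C = "comp_cover_product (family I) k A B"
  let ?s1 = "set_scal h n (start_store I k)"
  let ?s2 = "set_scal (Suc h) k ?s1"
  let ?s3 = "set_scal 2 0 ?s2"
  let ?s4 = "set_scal (Suc h) k (set_scal h n s)"
  let ?s5 = "set_scal 1 n ?s4"
  let ?s6 = "set_scal 2 k ?s5"
  have start: "scal (start_store I k) 0 = n" "scal (start_store I k) 2 = k"
    by (simp_all add: start_store_def n_def)
  have s: "scal s 0 = F" "lists_family (arr s 1)"
    using L(3) by (simp_all add: outputs_listing_def lists_family_def F_def n_def bitstring_def)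
  have zero: "arr s h = (\<lambda>_. 0)"
    using exec_arr_fresh[OF L(1,2)] h_ge by (simp add: start_store_def)
  have "wp V (cover_program L h)
      (0 + (0 + (0 + (0 + (0 + (0 + (0 + (0 + (?X + (?X + (?N + ?X)))))))))))
      (Suc (exp_ops (Var 0)) + (Suc (exp_ops (Var 2)) + (Suc (exp_ops (Num 0)) + (t +
      (Suc (exp_ops (Var h)) + (Suc (exp_ops (Var (Suc h))) + ((k * 12 + 8) +
      ((F * (n * 23 + 26) + 6) + ((114 * ?X + 8) + ((114 * ?X + 8) + ((?N * 12 + 6) +
      (114 * ?X + 8))))))))))))
      (\<lambda>(s', m'). holds (m' 2) ?C) (start_store I k, m)"
    unfolding cover_program_def
  proof (rule wp_Seq, rule wp_Assign_value[where v = n], rule_tac[3] wp_Seq,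
      rule_tac[3] wp_Assign_value[where v = k], rule_tac[5] wp_Seq,
      rule_tac[5] wp_Assign_value[where v = 0], rule_tac[7] wp_Seq,
      rule_tac[7] wp_exec[where s' = ?s4], rule_tac[8] wp_Seq,
      rule_tac[8] wp_Assign_value[where v = n], rule_tac[10] wp_Seq,
      rule_tac[10] wp_Assign_value[where v = k], rule_tac[12] wp_Seq,
      rule_tac[12] wp_table_size)
    show "exec L ?s3 t ?s4" by (rule exec_listing[OF L(1,2)])
  next
    fix s' :: store assume s': "scal s' 0 = F" "scal s' 1 = scal ?s6 1" "scal s' 2 = k" "scal s' 3 = ?N"
      "arr s' = arr ?s6"
    show "wp V (RSeq (rfor 4 0 (code_member h)) (RSeq (transform h 0 RAdd)
        (RSeq (transform h 1 RAdd) (RSeq multiply_tables (transform h 2 RSub)))))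
        (0 + (?X + (?X + (?N + ?X))))
        ((F * (n * 23 + 26) + 6) + ((114 * ?X + 8) + ((114 * ?X + 8) + ((?N * 12 + 6) +
          (114 * ?X + 8)))))
        (\<lambda>(s', m'). holds (m' 2) ?C) (s', m)"
    proof (rule wp_Seq, rule wp_code_members)
      show "params s'" "lists_family (arr s' 1)" "arr s' h = (\<lambda>_. 0)"
        using s' s zero by (simp_all add: params_def)
      fix s1 assume s1: "base s1"
      show "wp V (RSeq (transform h 0 RAdd)
          (RSeq (transform h 1 RAdd) (RSeq multiply_tables (transform h 2 RSub))))
          (?X + (?X + (?N + ?X)))
          ((114 * ?X + 8) + ((114 * ?X + 8) + ((?N * 12 + 6) + (114 * ?X + 8))))
          (\<lambda>(s', m'). holds (m' 2) ?C) (s1, m)"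
      proof (rule wp_Seq, rule wp_zeta[where m = m and a = 0 and A = A, OF s1 A])
        fix s2 m2 assume s2: "base s2" and m2: "\<And>b. b \<noteq> 0 \<Longrightarrow> m2 b = m b"
          "holds (m2 0) (zeta k ?U A)"
        have B2: "holds (m2 1) B" using B m2(1) by simp
        show "wp V (RSeq (transform h 1 RAdd) (RSeq multiply_tables (transform h 2 RSub)))
            (?X + (?N + ?X)) ((114 * ?X + 8) + ((?N * 12 + 6) + (114 * ?X + 8)))
            (\<lambda>(s', m'). holds (m' 2) ?C) (s2, m2)"
        proof (rule wp_Seq, rule wp_zeta[where m = m2 and a = 1 and A = B, OF s2 B2])
          fix s3 m3 assume s3: "base s3" and m3: "\<And>b. b \<noteq> 1 \<Longrightarrow> m3 b = m2 b"
            "holds (m3 1) (zeta k ?U B)"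
          show "wp V (RSeq multiply_tables (transform h 2 RSub))
              (?N + ?X) ((?N * 12 + 6) + (114 * ?X + 8))
              (\<lambda>(s', m'). holds (m' 2) ?C) (s3, m3)"
          proof (rule wp_Seq, rule wp_multiply_tables[OF s3])
            fix s4 and m4 :: "nat \<Rightarrow> nat \<Rightarrow> 'r"
            assume s4: "base s4" and m4: "\<And>x. x < ?N \<Longrightarrow> m4 2 x = m3 0 x * m3 1 x"
            \<comment> \<open>By \<open>zeta_mult\<close> the pointwise product is the transform of
              the wanted table; only the inversion remains.\<close>
            have "holds (m4 2) (zeta k ?U ?C)"
              using m2(2) m3 m4 tuple_index_less zeta_mult[of _ k A B] by (simp add: holds_table_def)
            then show "wp V (transform h 2 RSub) ?X (114 * ?X + 8)
                (\<lambda>(s', m'). holds (m' 2) ?C) (s4, m4)"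
              by (rule wp_moebius[OF s4]) simp
          qed
        qed
      qed
    qed
  qed (use start s le_V h_ge in simp_all)
  then show ?thesis
  proof (rule wp_mono)
    have N_pos: "1 \<le> ?N" using F_pos by (simp add: Suc_leI)
    have kn: "1 \<le> k * n" using k_pos n_pos by simp
    have NX: "?N \<le> ?X" using mult_le_mono1[OF kn, of ?N] by (simp add: mult.assoc)
    then show "0 + (0 + (0 + (0 + (0 + (0 + (0 + (0 + (?X + (?X + (?N + ?X))))))))))
        \<le> 4 * ?X" by simp
    have "k * n \<le> ?X"
      using mult_le_mono2[OF mult_le_mono2[OF N_pos], of k n] by simp
    then have kX: "k \<le> ?X" using n_pos by (metis le_trans mult.right_neutral mult_le_mono2 Suc_leI One_nat_def)
    have FN: "F \<le> ?N" using power_le_table_size[of 1] k_pos by simp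
    have "F * n \<le> ?N * (k * n)" using FN n_le_kn by (rule mult_le_mono)
    then have FnX: "F * n \<le> ?X" by (simp add: ac_simps)
    \<comment> \<open>The transforms contribute 3 * 114 = 342 multiples of \<open>?X\<close>, the
      other loops 12 + 23 + 26 + 12 and the constants 54: together 469, rounded up to 500.\<close>
    have "F * (n * 23 + 26) = 23 * (F * n) + 26 * F" by (simp add: algebra_simps)
    then show "(Suc (exp_ops (Var 0)) + (Suc (exp_ops (Var 2)) + (Suc (exp_ops (Num 0)) + (t +
      (Suc (exp_ops (Var h)) + (Suc (exp_ops (Var (Suc h))) + ((k * 12 + 8) +
      ((F * (n * 23 + 26) + 6) + ((114 * ?X + 8) + ((114 * ?X + 8) + ((?N * 12 + 6) +
      (114 * ?X + 8)))))))))))) \<le> 500 * ?X + t"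
      using NX kX FnX FN N_pos unfolding exp_ops.simps by linarith
  qed simp_all
qed

section \<open>From operation counts to the final bounds\<close>

lemma bit_length_V: "(bit_length V)\<^sup>2 \<le> 25 * (k * n)\<^sup>2"
proof -
  have "1 \<le> k * n" using k_pos n_pos by simp
  \<comment> \<open>The length is exactly \<open>2 * (k * n) + 3\<close>, and \<open>k * n\<close>
    is at least 1.\<close>
  then have "bit_length V \<le> 5 * (k * n)"
    unfolding V_def bit_length_def floor_log_power by linarith
  then have "(bit_length V)\<^sup>2 \<le> (5 * (k * n))\<^sup>2" by (rule power_mono) simp
  then show ?thesis by (simp add: power_mult_distrib)
qed

text \<open>The exponent \<open>d + 3\<close> collects \<open>d\<close> from \<open>L\<close>, 1
  from the passes over the tables and 2 from the squared bit length; 12500 is 25 * 500.\<close>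

lemma time_bound:
  assumes t: "t \<le> c * (F * n ^ d)"
  shows "(500 * (k * (n * F ^ k)) + t) * (bit_length V)\<^sup>2
    \<le> (12500 + 25 * c) * (k * n) ^ (d + 3) * F ^ k"
proof -
  have kn: "1 \<le> k * n" using k_pos n_pos by simp
  have FN: "F \<le> F ^ k" using power_le_table_size[of 1] k_pos by simp
  have "k * (n * F ^ k) = (k * n) ^ 1 * F ^ k" by simp
  also have "\<dots> \<le> (k * n) ^ (d + 1) * F ^ k"
    using kn by (intro mult_right_mono power_increasing) simp_all
  finally have 1: "k * (n * F ^ k) \<le> (k * n) ^ (d + 1) * F ^ k" .
  have "n ^ d \<le> (k * n) ^ d" using n_le_kn by (rule power_mono) simp
  also have "\<dots> \<le> (k * n) ^ (d + 1)" using kn by (intro power_increasing) simp_all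
  finally have "F * n ^ d \<le> F ^ k * (k * n) ^ (d + 1)" using FN by (intro mult_le_mono)
  then have "t \<le> c * ((k * n) ^ (d + 1) * F ^ k)"
    using t by (metis le_trans mult.commute mult_le_mono2)
  with 1 have "500 * (k * (n * F ^ k)) + t \<le> (500 + c) * ((k * n) ^ (d + 1) * F ^ k)"
    unfolding add_mult_distrib by linarith
  then have "(500 * (k * (n * F ^ k)) + t) * (bit_length V)\<^sup>2
      \<le> (500 + c) * ((k * n) ^ (d + 1) * F ^ k) * (25 * (k * n)\<^sup>2)"
    using bit_length_V by (rule mult_le_mono)
  also have "\<dots> = (25 * (500 + c)) * ((k * n) ^ (d + 1) * (k * n)\<^sup>2) * F ^ k"
    by (simp only: ac_simps)
  also have "(k * n) ^ (d + 1) * (k * n)\<^sup>2 = (k * n) ^ (d + 3)"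
    unfolding power_add[symmetric] by (rule arg_cong) simp
  also have "25 * (500 + c) = 12500 + 25 * c" by simp
  finally show ?thesis .
qed

lemma computes_cover_program:
  fixes A B :: "(nat \<Rightarrow> 'u set) \<Rightarrow> 'r::{comm_ring,comm_monoid_mult}"
  assumes L: "exec L (start_store I 0) t s" "com_bound L \<le> h" "outputs_listing I s"
    and t: "t \<le> c * (F * n ^ d)"
  shows "computes_comp_cover (cover_program L h) I k A B (4 * (k * F ^ k * n))
    ((12500 + 25 * c) * (k * n) ^ (d + 3) * F ^ k)"
  unfolding computes_comp_cover_def
proof (intro allI impI, elim conjE)
  fix m :: "nat \<Rightarrow> nat \<Rightarrow> 'r"
  assume "holds (m 0) A" "holds (m 1) B"
  from wp_cover_program[OF L this] obtain r t' s' m' where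
    exec: "rexec (cover_program L h) (start_store I k, m) r t' (s', m')"
    and r: "r \<le> 4 * (k * (n * F ^ k))"
    and t': "t' \<le> (500 * (k * (n * F ^ k)) + t) * (bit_length V)\<^sup>2"
    and result: "holds (m' 2) (comp_cover_product (family I) k A B)"
    unfolding wp_def by auto
  show "\<exists>r t s m'. rexec (cover_program L h) (start_store I k, m) r t (s, m') \<and>
      holds_table I k (m' 2) (comp_cover_product (family I) k A B) \<and>
      r \<le> 4 * (k * F ^ k * n) \<and> t \<le> (12500 + 25 * c) * (k * n) ^ (d + 3) * F ^ k"
  proof (intro exI conjI)
    show "holds_table I k (m' 2) (comp_cover_product (family I) k A B)"
      by (rule result)
    show "r \<le> 4 * (k * F ^ k * n)"
      using r by (simp only: ac_simps)
  qed (rule exec, rule le_trans[OF t' time_bound[OF t]])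
qed

end

theorem theorem50:
  fixes \<I> :: "'u set_system set"
  assumes "\<And>I. I \<in> \<I> \<Longrightarrow> distinct (ground I) \<and> universe I \<noteq> {}"
    and "\<And>I. I \<in> \<I> \<Longrightarrow> family I \<subseteq> Pow (universe I)"
    and "\<And>I. I \<in> \<I> \<Longrightarrow> closure_difference (universe I) (family I)"
    and "efficiently_listable \<I>"
  shows "\<exists>P c d. \<forall>I\<in>\<I>. \<forall>k\<ge>1. \<forall>A B :: (nat \<Rightarrow> 'u set) \<Rightarrow> 'r::{comm_ring,comm_monoid_mult}.
           computes_comp_cover P I k A B
             (c * (k * card (family I) ^ k * card (universe I)))
             (c * (k * card (universe I)) ^ d * card (family I) ^ k)"
proof -
  obtain L c d where L: "\<forall>I\<in>\<I>. \<exists>t s. exec L (start_store I 0) t s \<and> outputs_listing I s \<and>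
      t \<le> c * (card (family I) * card (universe I) ^ d)"
    using assms(4) unfolding efficiently_listable_def by blast
  define h where "h = max 3 (com_bound L)"
  show ?thesis
  \<comment> \<open>The witnesses stay schematic before \<open>I\<close> and \<open>k\<close> are
    fixed, so they can depend only on \<open>L\<close>, \<open>h\<close>, \<open>c\<close> and
    \<open>d\<close>: one program serves all instances.\<close>
  proof (intro exI ballI allI impI)
    fix I and k :: nat and A B :: "(nat \<Rightarrow> 'u set) \<Rightarrow> 'r"
    assume I: "I \<in> \<I>" and k: "1 \<le> k"
    obtain t s where t: "exec L (start_store I 0) t s" "outputs_listing I s"
      "t \<le> c * (card (family I) * card (universe I) ^ d)"
      using L I by blast
    have "family I \<noteq> {}"
      \<comment> \<open>For an empty family the listing bound would be 0, but every halting run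
        takes positive time.\<close>
      using t(3) exec_time_pos[OF t(1)] by auto
    then interpret cover_instance I k h
      using assms(1-3)[OF I] k by unfold_locales (auto simp: h_def)
    have "computes_comp_cover (cover_program L h) I k A B (4 * (k * F ^ k * n))
        ((12500 + 25 * c) * (k * n) ^ (d + 3) * F ^ k)"
      by (rule computes_cover_program[OF t(1) _ t(2)])
        (use t(3) in \<open>simp_all add: h_def F_def card_universe\<close>)
    \<comment> \<open>The theorem asks for one constant in both bounds, so the factor 4 is raised to
      the constant of the time bound.\<close>
    moreover have "4 * (k * F ^ k * n) \<le> (12500 + 25 * c) * (k * F ^ k * n)"
      by (intro mult_right_mono) simp_all
    ultimately show "computes_comp_cover (cover_program L h) I k A B
        ((12500 + 25 * c) * (k * card (family I) ^ k * card (universe I)))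
        ((12500 + 25 * c) * (k * card (universe I)) ^ (d + 3) * card (family I) ^ k)"
      unfolding computes_comp_cover_def F_def card_universe by (meson le_trans)
  qed
qed

end
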